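(* Let $K$ be any field and let $F$ be a polynomial automorphism of the plane over $K$ (an invertible polynomial map in $K[X_1,X_2]^2$; no assumption on $F(0)$). The following are equivalent: (1) $F$ is a composition of finitely many Pascal finite automorphisms of the plane over $K$; (2) $\det J_F=1$.
   Context: Let $K$ be a field, $X=(X_1,\dots,X_n)$ (here $n=2$). A polynomial map is a tuple $F=(F_1,\dots,F_n)\in K[X]^n$; it is invertible (a polynomial automorphism) if there is $G\in K[X]^n$ with $F\circ G=G\circ F=(X_1,\dots,X_n)$. Composition is functional: $(F\circ G)(X)=F(G(X))$. $J_F=(\partial F_i/\partial X_j)$ is the Jacobian matrix. For $P\in K[X]$ put $\sigma_F(P)=P\circ F$ and $\Delta_F(P)=P\circ F-P$. $F$ is Pascal finite if there is an integer $m\ge 1$ with $\Delta_F^m(X_i)=0$ for all $i=1,\dots,n$. *)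

theory Defs
  imports "HOL-Computational_Algebra.Polynomial" "HOL-Analysis.Determinants"
begin

text \<open>
  \<open>K[X\<^sub>1,X\<^sub>2]\<close> is represented as \<open>K[X\<^sub>1][X\<^sub>2]\<close>: the outer polynomial variable is \<open>X\<^sub>2\<close>, the
  inner one is \<open>X\<^sub>1\<close>. Note that \<open>2 = 0\<close> in the index type \<open>2\<close>, whose elements are \<open>1\<close> and \<open>2\<close>.
\<close>

type_synonym 'a bipoly = "'a poly poly"
type_synonym 'a polymap = "'a bipoly ^ 2"

definition bconst :: "'a::field \<Rightarrow> 'a bipoly" where
  "bconst a = [:[:a:]:]"

definition Xs :: "'a::field polymap" where
  "Xs = (\<chi> i. if i = 1 then [:[:0, 1:]:] else [:0, 1:])"

definition subst :: "'a::field bipoly \<Rightarrow> 'a polymap \<Rightarrow> 'a bipoly" where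
  "subst P F = poly (map_poly (\<lambda>p. poly (map_poly bconst p) (F $ 1)) P) (F $ 2)"

definition pmcomp :: "'a::field polymap \<Rightarrow> 'a polymap \<Rightarrow> 'a polymap" where
  "pmcomp F G = (\<chi> i. subst (F $ i) G)"

definition poly_automorphism :: "'a::field polymap \<Rightarrow> bool" where
  "poly_automorphism F \<longleftrightarrow> (\<exists>G. pmcomp F G = Xs \<and> pmcomp G F = Xs)"

definition partial_deriv :: "2 \<Rightarrow> 'a::field bipoly \<Rightarrow> 'a bipoly" where
  "partial_deriv j P = (if j = 1 then map_poly pderiv P else pderiv P)"

definition jacobian_matrix :: "'a::field polymap \<Rightarrow> 'a bipoly ^ 2 ^ 2" where
  "jacobian_matrix F = (\<chi> i j. partial_deriv j (F $ i))"

definition Delta :: "'a::field polymap \<Rightarrow> 'a bipoly \<Rightarrow> 'a bipoly" where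
  "Delta F P = subst P F - P"

definition pascal_finite :: "'a::field polymap \<Rightarrow> bool" where
  "pascal_finite F \<longleftrightarrow> (\<exists>m\<ge>1. \<forall>i. (Delta F ^^ m) (Xs $ i) = 0)"

text \<open>The empty composition is the identity map \<open>Xs\<close>, which is itself Pascal finite.\<close>

definition pmcomp_list :: "'a::field polymap list \<Rightarrow> 'a polymap" where
  "pmcomp_list Fs = foldr pmcomp Fs Xs"

lemma bconst_simps [simp]:
  "bconst 0 = 0" "bconst 1 = 1" "bconst (a + b) = bconst a + bconst b"
  "bconst (a * b) = bconst a * bconst b"
  by (simp_all add: bconst_def one_pCons)

lemma subst_bconst [simp]: "subst (bconst a) F = bconst a"
  by (simp add: subst_def bconst_def map_poly_pCons)

lemma subst_Xs [simp]: "subst (Xs $ i) F = F $ i"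
  using exhaust_2[of i] by (auto simp: subst_def Xs_def map_poly_pCons)

lemma map_poly_bconst_simps:
  "map_poly bconst (p + q) = map_poly bconst p + map_poly bconst q"
  "map_poly bconst (p * q) = map_poly bconst p * map_poly bconst q"
proof -
  show add: "map_poly bconst (p + q) = map_poly bconst p + map_poly bconst q" for p q
    by (rule poly_eqI) (simp add: coeff_map_poly)
  have smult: "map_poly bconst (smult a q) = smult (bconst a) (map_poly bconst q)" for a q
    by (rule poly_eqI) (simp add: coeff_map_poly)
  show "map_poly bconst (p * q) = map_poly bconst p * map_poly bconst q"
    by (induction p) (simp_all add: map_poly_pCons add smult)
qed

lemma subst_add [simp]: "subst (P + Q) F = subst P F + subst Q F"
proof -
  let ?h = "\<lambda>p. poly (map_poly bconst p) (F $ 1)"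
  have "map_poly ?h (P + Q) = map_poly ?h P + map_poly ?h Q"
    by (rule poly_eqI) (simp add: coeff_map_poly map_poly_bconst_simps)
  then show ?thesis
    by (simp add: subst_def)
qed

lemma subst_mult [simp]: "subst (P * Q) F = subst P F * subst Q F"
proof -
  let ?h = "\<lambda>p. poly (map_poly bconst p) (F $ 1)"
  have add: "map_poly ?h (P + Q) = map_poly ?h P + map_poly ?h Q" for P Q
    by (rule poly_eqI) (simp add: coeff_map_poly map_poly_bconst_simps)
  have smult: "map_poly ?h (smult p Q) = smult (?h p) (map_poly ?h Q)" for p Q
    by (rule poly_eqI) (simp add: coeff_map_poly map_poly_bconst_simps)
  have "map_poly ?h (P * Q) = map_poly ?h P * map_poly ?h Q"
    by (induction P) (simp_all add: map_poly_pCons add smult)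
  then show ?thesis
    by (simp add: subst_def)
qed

lemma pmcomp_Xs [simp]: "pmcomp Xs F = F"
  by (simp add: pmcomp_def vec_eq_iff)

lemma partial_deriv_Xs: "partial_deriv j (Xs $ i) = (if i = j then 1 else 0)"
  using exhaust_2[of i] exhaust_2[of j]
  by (auto simp: partial_deriv_def Xs_def map_poly_pCons pderiv_pCons one_pCons)

end

theory Submission
  imports Defs "HOL-Computational_Algebra.Formal_Laurent_Series"
begin

text \<open>
  A Pascal finite \<open>F\<close> makes \<open>P \<mapsto> P \<circ> F\<close> locally unipotent on \<open>K[X\<^sub>1,X\<^sub>2]\<close>, and the Jacobian determinant
  of \<open>F\<close> shows up as an eigenvalue of this operator, hence is 1.

  Conversely, by Jung and van der Kulk an automorphism is a product of shears \<open>(x + p(y), y)\<close>,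
  \<open>(x, y + q(x))\<close> and a diagonal map; shears are Pascal finite of determinant 1, and a diagonal map of
  determinant 1 is a product of shears. The proof of the Jung--van der Kulk theorem given here works in
  every characteristic. Let \<open>F = (x, y)\<close> with \<open>x, y \<in> K[u,v]\<close> of degrees \<open>q N\<close>, \<open>p N\<close> in \<open>v\<close>, where \<open>p\<close>, \<open>q\<close>
  are coprime, and let \<open>\<nu>\<close> be minus the degree in \<open>v\<close>. For elements \<open>s\<close>, \<open>t\<close> of positive \<open>\<nu>\<close> and a
  polynomial \<open>P\<close> of multiplicity \<open>\<mu>\<close> at the origin, \<open>\<nu>(P(s,t)) \<le> \<mu> J\<close> where \<open>J\<close> is the order of the Jacobian of
  \<open>(s,t)\<close> with respect to \<open>(u, 1/v)\<close>: blowing up the origin lowers \<open>J\<close> by \<open>m = min (\<nu> s) (\<nu> t)\<close> and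
  \<open>\<nu>(P(s,t))\<close> by \<open>\<mu> m\<close>. Applied at infinity to the first component \<open>f\<close> of the inverse map, for which
  \<open>\<nu>(f(x,y)) = \<nu>(u) = 0\<close>, this yields \<open>p q N \<le> (p + q + 1) N - 2\<close>. So \<open>p = 1\<close> or \<open>q = 1\<close>, and moreover \<open>x\<^sup>p / y\<^sup>q\<close> has a
  constant residue, so that a shear lowers the degree of \<open>x\<close> or \<open>y\<close>.
\<close>

no_notation fps_nth (infixl \<open>$\<close> 75)
notation fls_nth (infixl \<open>$$\<close> 75)

subsection \<open>Polynomial maps of the plane\<close>

text \<open>Constants and coordinates generate the polynomial ring, so identities between ring
  homomorphisms or derivations need checking only there.\<close>

lemma bipoly_induct [case_names const var add mult]:
  fixes P :: "'a::field bipoly"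
  assumes "\<And>a. Q (bconst a)" "\<And>i. Q (Xs $ i)"
    and "\<And>P R. Q P \<Longrightarrow> Q R \<Longrightarrow> Q (P + R)" "\<And>P R. Q P \<Longrightarrow> Q R \<Longrightarrow> Q (P * R)"
  shows "Q P"
proof (induction P)
  case 0
  then show ?case using assms(1)[of 0] by simp
next
  case (pCons p P)
  have "Q [:p:]" for p
  proof (induction p)
    case 0
    then show ?case using assms(1)[of 0] by simp
  next
    case (pCons a p)
    have "Q (bconst a + Xs $ 1 * [:p:])"
      by (intro assms pCons.IH)
    then show ?case by (simp add: bconst_def Xs_def)
  qed
  then have "Q ([:p:] + Xs $ 2 * P)"
    by (intro assms pCons.IH)
  then show ?case by (simp add: Xs_def)
qed

lemma bconst_eq_iff [simp]: "bconst a = bconst b \<longleftrightarrow> a = b"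
  by (simp add: bconst_def)

lemma bconst_0_iff [simp]: "bconst a = 0 \<longleftrightarrow> a = 0"
  by (simp add: bconst_def)

lemma bconst_diff [simp]: "bconst (a - b) = bconst a - bconst b"
  by (simp add: bconst_def)

lemma bconst_minus [simp]: "bconst (- a) = - bconst a"
  by (simp add: bconst_def)

lemma subst_0 [simp]: "subst 0 F = 0"
  by (simp add: subst_def)

lemma subst_1 [simp]: "subst 1 F = 1"
  using subst_bconst[of 1 F] by simp

lemma subst_minus [simp]: "subst (- P) F = - subst P F"
  using subst_add[of P "- P" F] by (simp add: eq_neg_iff_add_eq_0 add.commute)

lemma subst_diff [simp]: "subst (P - Q) F = subst P F - subst Q F"
  using subst_add[of P "- Q" F] by simp

lemma subst_subst: "subst (subst P F) G = subst P (pmcomp F G)"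
  by (induction P rule: bipoly_induct) (auto simp: pmcomp_def)

lemma pmcomp_assoc: "pmcomp (pmcomp F G) H = pmcomp F (pmcomp G H)"
  by (simp add: vec_eq_iff pmcomp_def[of _ H] pmcomp_def[of F] subst_subst)

lemma subst_id [simp]: "subst P Xs = P"
  by (induction P rule: bipoly_induct) auto

lemma pmcomp_id [simp]: "pmcomp F Xs = F"
  by (simp add: pmcomp_def vec_eq_iff)

lemma poly_automorphism_pmcomp:
  assumes "poly_automorphism F" "poly_automorphism G"
  shows "poly_automorphism (pmcomp F G)"
proof -
  obtain F' G' where *: "pmcomp F F' = Xs" "pmcomp F' F = Xs" "pmcomp G G' = Xs" "pmcomp G' G = Xs"
    using assms by (auto simp: poly_automorphism_def)
  have "pmcomp (pmcomp F G) (pmcomp G' F') = pmcomp F (pmcomp (pmcomp G G') F')"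
    "pmcomp (pmcomp G' F') (pmcomp F G) = pmcomp G' (pmcomp (pmcomp F' F) G)"
    by (simp_all only: pmcomp_assoc)
  then show ?thesis
    unfolding poly_automorphism_def using * by (metis pmcomp_Xs)
qed

section \<open>Partial derivatives, the chain rule and Jacobians\<close>

lemma partial_deriv_add [simp]: "partial_deriv j (P + Q) = partial_deriv j P + partial_deriv j Q"
proof -
  have "map_poly pderiv (P + Q) = map_poly pderiv P + map_poly pderiv Q"
    by (rule poly_eqI) (simp add: coeff_map_poly pderiv_add)
  then show ?thesis by (simp add: partial_deriv_def pderiv_add)
qed

lemma pderiv_sum: "pderiv (sum f A) = (\<Sum>x\<in>A. pderiv (f x))"
  by (induction A rule: infinite_finite_induct) (auto simp: pderiv_add)

lemma partial_deriv_mult [simp]: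
  "partial_deriv j (P * Q) = P * partial_deriv j Q + Q * partial_deriv j P"
proof -
  have "map_poly pderiv (P * Q) = P * map_poly pderiv Q + map_poly pderiv P * Q"
    by (rule poly_eqI)
      (simp add: coeff_map_poly coeff_mult pderiv_sum pderiv_mult sum.distrib, simp add: mult.commute)
  then show ?thesis by (simp add: partial_deriv_def pderiv_mult mult.commute)
qed

lemma partial_deriv_bconst [simp]: "partial_deriv j (bconst a) = 0"
  by (simp add: partial_deriv_def bconst_def map_poly_pCons pderiv_pCons)

lemma partial_deriv_0 [simp]: "partial_deriv j 0 = 0"
  using partial_deriv_bconst[of j 0] by simp

lemma partial_deriv_subst:
  "partial_deriv j (subst P F) = subst (partial_deriv 1 P) F * partial_deriv j (F $ 1)
    + subst (partial_deriv 2 P) F * partial_deriv j (F $ 2)"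
proof (induction P rule: bipoly_induct)
  case (var i)
  then show ?case using exhaust_2[of i] by (auto simp: partial_deriv_Xs)
qed (auto simp: algebra_simps)

text \<open>It takes two polynomials rather than a map, so that it also applies to iterated
  differences of the coordinates.\<close>

definition jacobian :: "'a::field bipoly \<Rightarrow> 'a bipoly \<Rightarrow> 'a bipoly" where
  "jacobian P Q = partial_deriv 1 P * partial_deriv 2 Q - partial_deriv 2 P * partial_deriv 1 Q"

lemma jacobian_add [simp]:
  "jacobian (P + P') Q = jacobian P Q + jacobian P' Q"
  "jacobian P (Q + Q') = jacobian P Q + jacobian P Q'"
  by (simp_all add: jacobian_def algebra_simps)

lemma jacobian_0 [simp]: "jacobian 0 Q = 0" "jacobian P 0 = 0"
  by (simp_all add: jacobian_def)

lemma jacobian_subst: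
  "jacobian (subst P F) (subst Q F) = subst (jacobian P Q) F * jacobian (F $ 1) (F $ 2)"
  by (simp add: jacobian_def partial_deriv_subst algebra_simps)

lemma jacobian_Xs [simp]: "jacobian (Xs $ 1) (Xs $ 2) = 1"
  by (simp add: jacobian_def partial_deriv_Xs)

lemma det_jacobian_matrix: "det (jacobian_matrix F) = jacobian (F $ 1) (F $ 2)"
  by (simp add: det_2 jacobian_matrix_def jacobian_def)

lemma det_jacobian_pmcomp:
  "det (jacobian_matrix (pmcomp F G)) = subst (det (jacobian_matrix F)) G * det (jacobian_matrix G)"
  using jacobian_subst[of "F $ 1" G "F $ 2"] by (simp add: det_jacobian_matrix pmcomp_def)

lemma det_jacobian_Xs [simp]: "det (jacobian_matrix Xs) = 1"
  by (simp add: det_jacobian_matrix)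

text \<open>By the chain rule the determinant divides 1, and the units of a polynomial ring over a
  field are the nonzero constants.\<close>

lemma det_jacobian_automorphism:
  assumes "poly_automorphism F"
  obtains c where "c \<noteq> 0" "det (jacobian_matrix F) = bconst c"
proof -
  obtain G where "pmcomp G F = Xs"
    using assms by (auto simp: poly_automorphism_def)
  then have "subst (det (jacobian_matrix G)) F * det (jacobian_matrix F) = 1"
    using det_jacobian_pmcomp[of G F] by simp
  then have "det (jacobian_matrix F) dvd 1"
    by (metis dvd_triv_right)
  then obtain q where "det (jacobian_matrix F) = [:q:]" "q dvd 1"
    by (auto simp: is_unit_poly_iff)
  then obtain c where "det (jacobian_matrix F) = [:[:c:]:]" "c dvd 1"
    by (auto simp: is_unit_poly_iff)
  then show thesis
    by (intro that[of c]) (auto simp: bconst_def)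
qed

subsection \<open>Pascal finite maps\<close>

lemma Delta_0 [simp]: "Delta F 0 = 0"
  by (simp add: Delta_def)

lemma Delta_add: "Delta F (P + Q) = Delta F P + Delta F Q"
  by (simp add: Delta_def)

lemma Delta_mult: "Delta F (P * Q) = Delta F P * Q + P * Delta F Q + Delta F P * Delta F Q"
  by (simp add: Delta_def algebra_simps)

lemma Delta_pow_0 [simp]: "(Delta F ^^ n) 0 = 0"
  by (induction n) auto

lemma Delta_pow_add: "(Delta F ^^ n) (P + Q) = (Delta F ^^ n) P + (Delta F ^^ n) Q"
  by (induction n) (auto simp: Delta_add)

lemma Delta_pow_le:
  assumes "(Delta F ^^ m) P = 0" "m \<le> n"
  shows "(Delta F ^^ n) P = 0"
proof -
  have "(Delta F ^^ n) P = (Delta F ^^ (n - m)) ((Delta F ^^ m) P)"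
    using assms(2) by (metis comp_apply funpow_add le_add_diff_inverse2)
  then show ?thesis by (simp add: assms)
qed

lemma Delta_nilpotent_add:
  assumes "(Delta F ^^ m) P = 0" "(Delta F ^^ n) Q = 0"
  shows "\<exists>k. (Delta F ^^ k) (P + Q) = 0"
  using Delta_pow_le[OF assms(1), of "max m n"] Delta_pow_le[OF assms(2), of "max m n"]
  by (intro exI[of _ "max m n"]) (simp add: Delta_pow_add)

text \<open>In each of the three terms of \<open>Delta_mult\<close> the operator has already hit a
  factor, so the sum of the two nilpotency exponents drops and induction on it works.\<close>

lemma Delta_nilpotent_mult:
  assumes "(Delta F ^^ m) P = 0" "(Delta F ^^ n) Q = 0"
  shows "\<exists>k. (Delta F ^^ k) (P * Q) = 0"
  using assms
proof (induction "m + n" arbitrary: m n P Q rule: less_induct)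
  case less
  show ?case
  proof (cases "m = 0 \<or> n = 0")
    case True
    then have "(Delta F ^^ 0) (P * Q) = 0" using less.prems by auto
    then show ?thesis by blast
  next
    case False
    then obtain m' n' where mn: "m = Suc m'" "n = Suc n'"
      by (metis not0_implies_Suc)
    then have P': "(Delta F ^^ m') (Delta F P) = 0" and Q': "(Delta F ^^ n') (Delta F Q) = 0"
      using less.prems by (simp_all add: funpow_Suc_right del: funpow.simps)
    obtain i j k where "(Delta F ^^ i) (Delta F P * Q) = 0" "(Delta F ^^ j) (P * Delta F Q) = 0"
      "(Delta F ^^ k) (Delta F P * Delta F Q) = 0"
      using less.hyps[OF _ P' less.prems(2)] less.hyps[OF _ less.prems(1) Q'] less.hyps[OF _ P' Q'] mn
      by auto
    then obtain l where "(Delta F ^^ l) (Delta F (P * Q)) = 0"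
      unfolding Delta_mult by (meson Delta_nilpotent_add)
    then have "(Delta F ^^ Suc l) (P * Q) = 0"
      by (simp add: funpow_Suc_right del: funpow.simps)
    then show ?thesis by blast
  qed
qed

lemma pascal_finite_nilpotent:
  assumes "pascal_finite F"
  shows "\<exists>k. (Delta F ^^ k) P = 0"
proof (induction P rule: bipoly_induct)
  case (const a)
  show ?case by (rule exI[of _ 1]) (simp add: Delta_def)
next
  case (var i)
  then show ?case using assms by (auto simp: pascal_finite_def)
qed (use Delta_nilpotent_add Delta_nilpotent_mult in blast)+

text \<open>Among the nonzero Jacobians of iterated differences of the coordinates one of maximal order
  is a nonzero semi-invariant of weight \<open>1 / c\<close>, where \<open>c\<close> is the Jacobian determinant; nilpotency of
  the difference operator forces \<open>c = 1\<close>.\<close>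

lemma pascal_finite_det_jacobian:
  assumes "poly_automorphism F" "pascal_finite F"
  shows "det (jacobian_matrix F) = 1"
proof -
  obtain c where c: "c \<noteq> 0" "det (jacobian_matrix F) = bconst c"
    using det_jacobian_automorphism assms(1) by blast
  obtain m where m: "\<And>i. (Delta F ^^ m) (Xs $ i) = 0"
    using assms(2) by (auto simp: pascal_finite_def)
  define W where "W = (\<lambda>a b. jacobian ((Delta F ^^ a) (Xs $ 1)) ((Delta F ^^ b) (Xs $ 2)))"
  define A where "A = {x. W (fst x) (snd x) \<noteq> 0}"
  have bound: "a < m \<and> b < m" if "W a b \<noteq> 0" for a b
  proof (rule ccontr)
    assume "\<not> ?thesis"
    then have "(Delta F ^^ a) (Xs $ 1) = 0 \<or> (Delta F ^^ b) (Xs $ 2) = 0"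
      using Delta_pow_le[OF m] by (auto simp: not_less)
    then show False using that by (auto simp: W_def)
  qed
  have "finite A"
    by (rule finite_subset[of _ "{..<m} \<times> {..<m}"]) (auto simp: A_def dest: bound)
  moreover have "(0, 0) \<in> A"
    by (simp add: A_def W_def)
  ultimately have fin: "finite ((\<lambda>y. fst y + snd y) ` A)" "(\<lambda>y. fst y + snd y) ` A \<noteq> {}"
    by auto
  then obtain x where x: "x \<in> A" "Max ((\<lambda>y. fst y + snd y) ` A) = fst x + snd x"
    using Max_in[OF fin] by (auto simp: image_iff)
  obtain a b where ab: "x = (a, b)" by (cases x)
  have vanish: "W a' b' = 0" if "a' + b' > a + b" for a' b'
  proof (rule ccontr)
    assume "W a' b' \<noteq> 0"
    then have "fst (a', b') + snd (a', b') \<le> Max ((\<lambda>y. fst y + snd y) ` A)"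
      by (intro Max_ge fin imageI) (simp add: A_def)
    then show False using that x(2) by (simp add: ab)
  qed
  define R where "R = W a b"
  have R: "R \<noteq> 0" using x(1) by (simp add: R_def A_def ab)
  define P Q where "P = (Delta F ^^ a) (Xs $ 1)" and "Q = (Delta F ^^ b) (Xs $ 2)"
  \<comment> \<open>Replacing \<open>P\<close>, \<open>Q\<close> by \<open>P + Delta F P\<close>,
    \<open>Q + Delta F Q\<close> adds only Jacobians of higher total order, which vanish by the
    maximality of \<open>a + b\<close>.\<close>
  have "jacobian (Delta F P) Q = 0" "jacobian P (Delta F Q) = 0" "jacobian (Delta F P) (Delta F Q) = 0"
    using vanish[of "Suc a" b] vanish[of a "Suc b"] vanish[of "Suc a" "Suc b"]
    by (simp_all add: W_def P_def Q_def)
  moreover have "subst P F = P + Delta F P" "subst Q F = Q + Delta F Q"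
    by (simp_all add: Delta_def)
  ultimately have sR_c: "subst R F * bconst c = R"
    using jacobian_subst[of P F Q] c(2) by (simp add: det_jacobian_matrix R_def W_def P_def Q_def)
  have "bconst (1 / c) * bconst c = 1"
    unfolding bconst_simps(4)[symmetric] using c by simp
  then have "subst R F = (bconst (1 / c) * bconst c) * subst R F"
    by simp
  also have "\<dots> = bconst (1 / c) * (subst R F * bconst c)"
    by (simp only: ac_simps)
  also have "\<dots> = bconst (1 / c) * R"
    by (simp only: sR_c)
  finally have sR: "subst R F = bconst (1 / c) * R" .
  have "(Delta F ^^ n) R = bconst ((1 / c - 1) ^ n) * R" for n
  proof (induction n)
    case (Suc n)
    have "(Delta F ^^ Suc n) R = Delta F (bconst ((1 / c - 1) ^ n) * R)"
      by (simp add: Suc.IH)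
    also have "\<dots> = bconst ((1 / c - 1) ^ n) * (bconst (1 / c) - 1) * R"
      by (simp add: Delta_def sR algebra_simps)
    also have "bconst (1 / c) - 1 = bconst (1 / c - 1)"
      by simp
    finally show ?case
      by (simp only: bconst_simps(4)[symmetric] power_Suc2)
  qed simp
  then have "(1 / c - 1) = 0"
    using pascal_finite_nilpotent[OF assms(2), of R] R by auto
  then show ?thesis
    using c by simp
qed

lemma det_jacobian_pmcomp_list:
  assumes "\<And>G. G \<in> set Fs \<Longrightarrow> det (jacobian_matrix G) = 1"
  shows "det (jacobian_matrix (pmcomp_list Fs)) = 1"
  using assms by (induction Fs) (auto simp: pmcomp_list_def det_jacobian_pmcomp)

subsection \<open>Shears\<close>

definition upoly :: "'a::field poly \<Rightarrow> 'a bipoly \<Rightarrow> 'a bipoly" where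
  "upoly p Q = poly (map_poly bconst p) Q"

lemma upoly_simps [simp]: "upoly 0 Q = 0" "upoly (pCons a p) Q = bconst a + Q * upoly p Q"
  by (simp_all add: upoly_def map_poly_pCons)

lemma upoly_add [simp]: "upoly (p + q) Q = upoly p Q + upoly q Q"
  by (simp add: upoly_def map_poly_bconst_simps)

lemma upoly_minus [simp]: "upoly (- p) Q = - upoly p Q"
  using upoly_add[of p "- p" Q] by (simp add: eq_neg_iff_add_eq_0 add.commute)

lemma upoly_monom [simp]: "upoly (monom a n) Q = bconst a * Q ^ n"
  by (induction n) (auto simp: monom_0 monom_Suc)

lemma subst_upoly [simp]: "subst (upoly p Q) F = upoly p (subst Q F)"
  by (induction p) auto

lemma partial_deriv_upoly: "partial_deriv j (upoly p Q) = upoly (pderiv p) Q * partial_deriv j Q"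
  by (induction p) (auto simp: pderiv_pCons algebra_simps)

text \<open>In the index type \<open>2\<close> we have \<open>2 + 1 = 1\<close>, so \<open>k + 1\<close> is the index other than \<open>k\<close>.\<close>
definition shear :: "2 \<Rightarrow> 'a::field poly \<Rightarrow> 'a polymap" where
  "shear i p = (\<chi> k. if k = i then Xs $ k + upoly p (Xs $ (k + 1)) else Xs $ k)"

lemma three_eq_one [simp]: "(3 :: 2) = 1"
  by simp

lemma index_neq [simp]: "(k :: 2) + 1 \<noteq> k"
  using exhaust_2[of k] by auto

lemma pmcomp_shear_nth:
  "pmcomp (shear i p) F $ k = (if k = i then F $ k + upoly p (F $ (k + 1)) else F $ k)"
  by (simp add: pmcomp_def shear_def)

lemma pmcomp_shear_inverse [simp]: "pmcomp (shear i (- p)) (pmcomp (shear i p) F) = F"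
  by (simp add: vec_eq_iff pmcomp_shear_nth)

lemma poly_automorphism_shear: "poly_automorphism (shear i p)"
  unfolding poly_automorphism_def
  using pmcomp_shear_inverse[of i p Xs] pmcomp_shear_inverse[of i "- p" Xs]
  by (intro exI[of _ "shear i (- p)"]) auto

lemma pascal_finite_shear: "pascal_finite (shear i p)"
  unfolding pascal_finite_def
proof (intro exI[of _ 2] conjI allI)
  fix k
  have "Delta (shear i p) (Xs $ k) = (if k = i then upoly p (Xs $ (k + 1)) else 0)"
    by (simp add: Delta_def shear_def)
  then show "(Delta (shear i p) ^^ 2) (Xs $ k) = 0"
    by (auto simp: numeral_2_eq_2 Delta_def shear_def)
qed simp

lemma det_jacobian_shear [simp]: "det (jacobian_matrix (shear i p)) = 1"
  using exhaust_2[of i]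
  by (auto simp: det_jacobian_matrix jacobian_def shear_def partial_deriv_upoly partial_deriv_Xs)

section \<open>Products of shears\<close>

text \<open>Shears are composed on the left only, where they act as elementary operations on the two
  components, as in the degree reduction.\<close>

inductive shear_reach :: "'a::field polymap \<Rightarrow> 'a polymap \<Rightarrow> bool" for H where
  base: "shear_reach H H"
| step: "shear_reach H F \<Longrightarrow> shear_reach H (pmcomp (shear i p) F)"

lemma shear_reach_trans: "shear_reach G H \<Longrightarrow> shear_reach H F \<Longrightarrow> shear_reach G F"
  by (rotate_tac 1, induction rule: shear_reach.induct) (auto intro: shear_reach.intros)

lemma shear_reach_cancel:
  assumes "shear_reach H (pmcomp (shear i p) F)"
  shows "shear_reach H F"
  using shear_reach.step[OF assms, of i "- p"] by simp

lemma shear_reach_list: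
  assumes "shear_reach Xs F"
  shows "\<exists>Fs. (\<forall>G\<in>set Fs. poly_automorphism G \<and> pascal_finite G) \<and> F = pmcomp_list Fs"
  using assms
proof induction
  case base
  show ?case by (rule exI[of _ "[]"]) (simp add: pmcomp_list_def)
next
  case (step F i p)
  then obtain Fs where "\<forall>G\<in>set Fs. poly_automorphism G \<and> pascal_finite G" "F = pmcomp_list Fs"
    by auto
  then show ?case
    by (intro exI[of _ "shear i p # Fs"])
      (simp add: pmcomp_list_def poly_automorphism_shear pascal_finite_shear)
qed

lemma det_jacobian_shear_reach:
  "shear_reach H F \<Longrightarrow> det (jacobian_matrix F) = det (jacobian_matrix H)"
  by (induction rule: shear_reach.induct) (auto simp: det_jacobian_pmcomp)

definition pair_map :: "'a bipoly \<Rightarrow> 'a bipoly \<Rightarrow> 'a::field polymap" where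
  "pair_map P Q = (\<chi> i. if i = 1 then P else Q)"

lemma pair_map_nth [simp]: "pair_map P Q $ 1 = P" "pair_map P Q $ 2 = Q"
  by (simp_all add: pair_map_def)

lemma pair_map_eq: "F = pair_map (F $ 1) (F $ 2)"
  by (simp add: vec_eq_iff forall_2)

lemma pmcomp_shear_pair_map:
  "pmcomp (shear 1 p) (pair_map P Q) = pair_map (P + upoly p Q) Q"
  "pmcomp (shear 2 p) (pair_map P Q) = pair_map P (Q + upoly p P)"
  by (simp_all add: vec_eq_iff forall_2 pmcomp_shear_nth)

text \<open>An antidiagonal matrix of determinant 1 is a product of three elementary ones:
  \<open>(P, Q)\<close> becomes \<open>(P + a Q, Q)\<close>, then \<open>(P + a Q, - P / a)\<close>,
  then \<open>(a Q, - P / a)\<close>.\<close>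

lemma rotate_eq:
  assumes "a \<noteq> 0"
  shows "pair_map (bconst a * Q) (bconst (- 1 / a) * P) =
    pmcomp (shear 1 [:0, a:]) (pmcomp (shear 2 [:0, - 1 / a:]) (pmcomp (shear 1 [:0, a:]) (pair_map P Q)))"
proof -
  define A e where "A = bconst a" and "e = bconst (1 / a)"
  have eA: "e * A = 1"
    unfolding A_def e_def bconst_simps(4)[symmetric] using assms by simp
  have 1: "pmcomp (shear 1 [:0, a:]) (pair_map P Q) = pair_map (P + Q * A) Q"
    by (simp add: pmcomp_shear_pair_map A_def)
  have neg: "bconst (- 1 / a) = - e"
    by (simp add: e_def flip: bconst_minus)
  have "pmcomp (shear 2 [:0, - 1 / a:]) (pair_map (P + Q * A) Q) = pair_map (P + Q * A) (Q + (P + Q * A) * (- e))"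
    using neg by (simp add: pmcomp_shear_pair_map)
  also have "Q + (P + Q * A) * (- e) = - e * P"
    using eA by algebra
  finally have 2: "pmcomp (shear 2 [:0, - 1 / a:]) (pair_map (P + Q * A) Q) = pair_map (P + Q * A) (- e * P)" .
  have "pmcomp (shear 1 [:0, a:]) (pair_map (P + Q * A) (- e * P)) = pair_map (P + Q * A + (- e * P) * A) (- e * P)"
    by (simp add: pmcomp_shear_pair_map A_def)
  also have "P + Q * A + (- e * P) * A = A * Q"
    using eA by algebra
  finally have 3: "pmcomp (shear 1 [:0, a:]) (pair_map (P + Q * A) (- e * P)) = pair_map (A * Q) (- e * P)" .
  show ?thesis
    unfolding 1 2 3 neg by (simp add: A_def)
qed

lemma shear_reach_rotate:
  assumes "a \<noteq> 0"
  shows "shear_reach H (pair_map (bconst a * Q) (bconst (- 1 / a) * P)) \<longleftrightarrow> shear_reach H (pair_map P Q)"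
  unfolding rotate_eq[OF assms] by (blast intro: shear_reach.step shear_reach_cancel)

definition diag :: "'a::field \<Rightarrow> 'a \<Rightarrow> 'a polymap" where
  "diag a b = pair_map (bconst a * Xs $ 1) (bconst b * Xs $ 2)"

lemma det_jacobian_diag: "det (jacobian_matrix (diag a b)) = bconst (a * b)"
  by (simp add: det_jacobian_matrix diag_def jacobian_def partial_deriv_Xs)

text \<open>A diagonal matrix of determinant 1 is the product of two antidiagonal ones, with
  parameters \<open>b\<close> and \<open>- 1\<close>.\<close>

lemma shear_reach_diag:
  assumes "a * b = 1"
  shows "shear_reach Xs (diag a b)"
proof -
  have b: "b \<noteq> 0" using assms by auto
  have a: "a = 1 / b" using assms b by (simp add: eq_divide_eq)
  have "shear_reach Xs (pair_map (Xs $ 1) (Xs $ 2))"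
    using pair_map_eq[of Xs] shear_reach.base by metis
  then have "shear_reach Xs (pair_map (bconst b * Xs $ 2) (bconst (- 1 / b) * Xs $ 1))"
    using shear_reach_rotate[OF b] by blast
  then have "shear_reach Xs (pair_map (bconst (- 1) * (bconst (- 1 / b) * Xs $ 1)) (bconst (- 1 / - 1) * (bconst b * Xs $ 2)))"
    by (subst shear_reach_rotate) auto
  then show ?thesis
    by (simp add: diag_def a)
qed

subsection \<open>Order of Laurent series\<close>

text \<open>A lower bound replaces \<open>fls_subdegree\<close>, which is 0 on the zero series; here
  the zero series satisfies every bound, so sums need no case distinction.\<close>

definition ord_ge :: "'b::zero fls \<Rightarrow> int \<Rightarrow> bool" where
  "ord_ge f k \<longleftrightarrow> (\<forall>n<k. f $$ n = 0)"

lemma ord_ge_iff: "f \<noteq> 0 \<Longrightarrow> ord_ge f k \<longleftrightarrow> k \<le> fls_subdegree f"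
  unfolding ord_ge_def by (meson fls_eq0_below_subdegree fls_subdegree_geI less_le_trans)

lemma ord_ge_subdegree: "ord_ge f (fls_subdegree f)"
  by (simp add: ord_ge_def)

lemma ord_ge_mono: "ord_ge f k \<Longrightarrow> l \<le> k \<Longrightarrow> ord_ge f l"
  by (auto simp: ord_ge_def)

lemma ord_ge_0 [simp]: "ord_ge 0 k"
  by (simp add: ord_ge_def)

lemma ord_ge_const [simp]: "ord_ge (fls_const c) 0"
  by (simp add: ord_ge_def)

lemma ord_ge_add: "ord_ge f k \<Longrightarrow> ord_ge g k \<Longrightarrow> ord_ge (f + g) k"
  for f :: "'b::comm_ring_1 fls"
  by (simp add: ord_ge_def)

lemma ord_ge_diff: "ord_ge f k \<Longrightarrow> ord_ge g k \<Longrightarrow> ord_ge (f - g) k"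
  for f :: "'b::comm_ring_1 fls"
  by (simp add: ord_ge_def)

text \<open>The convolution may run over any range given by lower bounds. The terms of the Leibniz
  rule, whose factors may differ in order, thus become sums over one common range.\<close>

lemma mult_nth_ord_ge:
  fixes f g :: "'b::comm_ring_1 fls"
  assumes "ord_ge f k" "ord_ge g l"
  shows "(f * g) $$ n = (\<Sum>i=k..n - l. f $$ i * g $$ (n - i))"
proof (cases "f = 0 \<or> g = 0")
  case False
  then have kl: "k \<le> fls_subdegree f" "l \<le> fls_subdegree g"
    using assms ord_ge_iff by blast+
  have "(f * g) $$ n = (\<Sum>i=fls_subdegree f..n - fls_subdegree g. f $$ i * g $$ (n - i))"
    by (rule fls_times_nth(2))
  also have "\<dots> = (\<Sum>i=k..n - l. f $$ i * g $$ (n - i))"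
    using kl by (intro sum.mono_neutral_left) auto
  finally show ?thesis .
qed auto

lemma ord_ge_mult:
  fixes f g :: "'b::comm_ring_1 fls"
  assumes "ord_ge f k" "ord_ge g l"
  shows "ord_ge (f * g) (k + l)"
  unfolding ord_ge_def by (simp add: mult_nth_ord_ge[OF assms])

lemma mult_nth_lowest:
  fixes f g :: "'b::comm_ring_1 fls"
  assumes "ord_ge f k" "ord_ge g l"
  shows "(f * g) $$ (k + l) = f $$ k * g $$ l"
  by (simp add: mult_nth_ord_ge[OF assms])

subsection \<open>Derivations of Laurent series\<close>

text \<open>On \<open>K((u))((w))\<close> this is the derivative in \<open>u\<close>, while
  \<open>fls_deriv\<close> is the derivative in \<open>w\<close>.\<close>

definition deriv_coeffs :: "'a::field fls fls \<Rightarrow> 'a fls fls" where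
  "deriv_coeffs f = Abs_fls (\<lambda>n. fls_deriv (f $$ n))"

lemma deriv_coeffs_nth [simp]: "deriv_coeffs f $$ n = fls_deriv (f $$ n)"
  unfolding deriv_coeffs_def
  by (rule nth_Abs_fls_lower_bound[of "fls_subdegree f"]) simp

lemma deriv_coeffs_add [simp]: "deriv_coeffs (f + g) = deriv_coeffs f + deriv_coeffs g"
  by (rule fls_eqI) simp

lemma deriv_coeffs_diff [simp]: "deriv_coeffs (f - g) = deriv_coeffs f - deriv_coeffs g"
  by (rule fls_eqI) simp

lemma deriv_coeffs_const [simp]: "deriv_coeffs (fls_const c) = fls_const (fls_deriv c)"
  by (rule fls_eqI) simp

lemma ord_ge_deriv_coeffs: "ord_ge f k \<Longrightarrow> ord_ge (deriv_coeffs f) k"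
  by (simp add: ord_ge_def)

lemma deriv_coeffs_mult [simp]:
  "deriv_coeffs (f * g) = f * deriv_coeffs g + deriv_coeffs f * g"
proof (rule fls_eqI)
  fix n
  note sd = ord_ge_subdegree[of f] ord_ge_subdegree[of g]
  note sd' = ord_ge_deriv_coeffs[OF sd(1)] ord_ge_deriv_coeffs[OF sd(2)]
  show "deriv_coeffs (f * g) $$ n = (f * deriv_coeffs g + deriv_coeffs f * g) $$ n"
    by (simp add: mult_nth_ord_ge[OF sd] mult_nth_ord_ge[OF sd'(1) sd(2)]
        mult_nth_ord_ge[OF sd(1) sd'(2)] fls_deriv_sum sum.distrib)
qed

lemma ord_ge_fls_deriv: "ord_ge f k \<Longrightarrow> ord_ge (fls_deriv f) (k - 1)"
  by (simp add: ord_ge_def)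

text \<open>The Jacobian determinant with respect to \<open>(u, w)\<close>.\<close>

definition bracket :: "'a::field fls fls \<Rightarrow> 'a fls fls \<Rightarrow> 'a fls fls" where
  "bracket f g = deriv_coeffs f * fls_deriv g - fls_deriv f * deriv_coeffs g"

definition scalar :: "'a::field \<Rightarrow> 'a fls fls" where
  "scalar a = fls_const (fls_const a)"

lemma scalar_simps [simp]:
  "scalar 0 = 0" "scalar 1 = 1" "scalar (a + b) = scalar a + scalar b"
  "scalar (a * b) = scalar a * scalar b"
  by (simp_all add: scalar_def fls_plus_const)

lemma scalar_nth [simp]: "scalar a $$ n = (if n = 0 then fls_const a else 0)"
  by (simp add: scalar_def)

lemma ord_ge_scalar [simp]: "ord_ge (scalar a) 0"
  by (simp add: scalar_def)

lemma bracket_swap: "bracket g f = - bracket f g"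
  by (simp add: bracket_def algebra_simps)

lemma bracket_mult_right: "bracket f (g * h) = g * bracket f h + bracket f g * h"
  by (simp add: bracket_def algebra_simps)

lemma bracket_self [simp]: "bracket f f = 0"
  by (simp add: bracket_def)

lemma bracket_diff_scalar [simp]: "bracket f (g - scalar a) = bracket f g"
  by (simp add: bracket_def scalar_def)

lemma bracket_0 [simp]: "bracket 0 f = 0" "bracket f 0 = 0"
proof -
  have "deriv_coeffs 0 = (0 :: 'a fls fls)"
    by (rule fls_eqI) simp
  then show "bracket 0 f = 0" "bracket f 0 = 0"
    by (simp_all add: bracket_def)
qed

text \<open>Only the derivative in \<open>w\<close> lowers the order, by 1, and it occurs once in
  each product.\<close>

lemma ord_ge_bracket:
  assumes "ord_ge f k" "ord_ge g l"
  shows "ord_ge (bracket f g) (k + l - 1)"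
proof -
  have "ord_ge (deriv_coeffs f * fls_deriv g) (k + (l - 1))"
    by (intro ord_ge_mult ord_ge_deriv_coeffs ord_ge_fls_deriv assms)
  moreover have "ord_ge (fls_deriv f * deriv_coeffs g) (k - 1 + l)"
    by (intro ord_ge_mult ord_ge_deriv_coeffs ord_ge_fls_deriv assms)
  ultimately show ?thesis
    unfolding bracket_def by (intro ord_ge_diff) (simp_all add: algebra_simps)
qed

subsection \<open>Bivariate polynomials evaluated at Laurent series\<close>

definition eval1 :: "'a::field fls fls \<Rightarrow> 'a poly \<Rightarrow> 'a fls fls" where
  "eval1 s p = poly (map_poly scalar p) s"

definition eval2 :: "'a::field fls fls \<Rightarrow> 'a fls fls \<Rightarrow> 'a bipoly \<Rightarrow> 'a fls fls" where
  "eval2 s t P = poly (map_poly (eval1 s) P) t"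

lemma eval1_simps [simp]: "eval1 s 0 = 0" "eval1 s (pCons a p) = scalar a + s * eval1 s p"
  by (simp_all add: eval1_def map_poly_pCons)

lemma eval1_add [simp]: "eval1 s (p + q) = eval1 s p + eval1 s q"
proof -
  have "map_poly scalar (p + q) = map_poly scalar p + map_poly scalar q"
    by (rule poly_eqI) (simp add: coeff_map_poly)
  then show ?thesis by (simp add: eval1_def)
qed

lemma eval1_smult [simp]: "eval1 s (smult a p) = scalar a * eval1 s p"
  by (induction p) (auto simp: algebra_simps)

lemma eval1_mult [simp]: "eval1 s (p * q) = eval1 s p * eval1 s q"
  by (induction p) (auto simp: algebra_simps)

lemma eval2_simps [simp]: "eval2 s t 0 = 0" "eval2 s t (pCons p P) = eval1 s p + t * eval2 s t P"
  by (simp_all add: eval2_def map_poly_pCons)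

lemma eval2_add [simp]: "eval2 s t (P + Q) = eval2 s t P + eval2 s t Q"
proof -
  have "map_poly (eval1 s) (P + Q) = map_poly (eval1 s) P + map_poly (eval1 s) Q"
    by (rule poly_eqI) (simp add: coeff_map_poly)
  then show ?thesis by (simp add: eval2_def)
qed

lemma eval2_smult [simp]: "eval2 s t (smult p P) = eval1 s p * eval2 s t P"
  by (induction P) (auto simp: algebra_simps)

lemma eval2_mult [simp]: "eval2 s t (P * Q) = eval2 s t P * eval2 s t Q"
  by (induction P) (auto simp: algebra_simps)

lemma eval2_sum: "eval2 s t (sum h A) = (\<Sum>x\<in>A. eval2 s t (h x))"
  by (induction A rule: infinite_finite_induct) auto

lemma eval1_monom [simp]: "eval1 s (monom a i) = scalar a * s ^ i"
  by (induction i) (auto simp: monom_Suc monom_0)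

lemma eval2_monom [simp]: "eval2 s t (monom p j) = eval1 s p * t ^ j"
  by (induction j) (auto simp: monom_Suc monom_0)

section \<open>Supports and monomial substitutions\<close>

definition supp :: "'a::zero poly poly \<Rightarrow> (nat \<times> nat) set" where
  "supp P = {(i, j). coeff (coeff P j) i \<noteq> 0}"

lemma finite_supp [simp]: "finite (supp P)"
proof (rule finite_subset)
  show "supp P \<subseteq> (\<Union>j\<le>degree P. (\<lambda>i. (i, j)) ` {..degree (coeff P j)})"
  proof
    fix x assume "x \<in> supp P"
    then obtain i j where x: "x = (i, j)" "coeff (coeff P j) i \<noteq> 0"
      by (auto simp: supp_def)
    then have "j \<le> degree P" "i \<le> degree (coeff P j)"
      by (auto intro!: le_degree)
    then show "x \<in> (\<Union>j\<le>degree P. (\<lambda>i. (i, j)) ` {..degree (coeff P j)})"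
      using x by auto
  qed
qed auto

lemma supp_iff: "(i, j) \<in> supp P \<longleftrightarrow> coeff (coeff P j) i \<noteq> 0"
  by (simp add: supp_def)

text \<open>Swapping the variables, blowing up and passing to the toric chart are all of this form;
  in each case \<open>h\<close> is injective on the support, so that no coefficients cancel.\<close>

definition move_monoms :: "(nat \<times> nat \<Rightarrow> nat \<times> nat) \<Rightarrow> 'a::comm_monoid_add poly poly \<Rightarrow> 'a poly poly" where
  "move_monoms h P = (\<Sum>x\<in>supp P. monom (monom (coeff (coeff P (snd x)) (fst x)) (fst (h x))) (snd (h x)))"

lemma coeff_move_monoms:
  "coeff (coeff (move_monoms h P) j) i =
    (\<Sum>x\<in>supp P. if h x = (i, j) then coeff (coeff P (snd x)) (fst x) else 0)"
  unfolding move_monoms_def coeff_sum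
  by (intro sum.cong refl) (auto simp: prod_eq_iff)

lemma move_monoms_id: "move_monoms (\<lambda>x. x) P = P"
proof (intro poly_eqI)
  fix i j
  have "coeff (coeff (move_monoms (\<lambda>x. x) P) j) i =
    (\<Sum>x\<in>supp P. if x = (i, j) then coeff (coeff P j) i else 0)"
    unfolding coeff_move_monoms by (intro sum.cong) auto
  also have "\<dots> = coeff (coeff P j) i"
    by (subst sum.delta) (simp_all add: supp_iff)
  finally show "coeff (coeff (move_monoms (\<lambda>x. x) P) j) i = coeff (coeff P j) i" .
qed

lemma supp_move_monoms_subset: "supp (move_monoms h P) \<subseteq> h ` supp P"
proof
  fix x assume "x \<in> supp (move_monoms h P)"
  then have "(\<Sum>y\<in>supp P. if h y = x then coeff (coeff P (snd y)) (fst y) else 0) \<noteq> 0"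
    using supp_iff[of "fst x" "snd x" "move_monoms h P"] unfolding coeff_move_monoms by simp
  then obtain y where "y \<in> supp P" "h y = x"
    by (auto elim!: sum.not_neutral_contains_not_neutral split: if_splits)
  then show "x \<in> h ` supp P" by auto
qed

lemma supp_move_monoms:
  assumes "inj_on h (supp P)"
  shows "supp (move_monoms h P) = h ` supp P"
proof
  show "h ` supp P \<subseteq> supp (move_monoms h P)"
  proof
    fix y assume "y \<in> h ` supp P"
    then obtain x where x: "x \<in> supp P" "y = h x" by auto
    have "(\<Sum>z\<in>supp P. if h z = h x then coeff (coeff P (snd z)) (fst z) else 0)
      = (\<Sum>z\<in>supp P. if z = x then coeff (coeff P (snd x)) (fst x) else 0)"
      using assms x by (intro sum.cong) (auto simp: inj_on_def)
    also have "\<dots> = coeff (coeff P (snd x)) (fst x)"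
      using x by (subst sum.delta) auto
    also have "\<dots> \<noteq> 0" using x by (auto simp: supp_def)
    finally show "y \<in> supp (move_monoms h P)"
      using x by (cases "h x") (auto simp: supp_def coeff_move_monoms)
  qed
qed (rule supp_move_monoms_subset)

text \<open>The factors \<open>A\<close> and \<open>B\<close> clear powers: the blow-up extracts
  \<open>B = s ^ \<mu>0\<close>, the chart at infinity multiplies by
  \<open>A = E ^ W\<close>.\<close>

lemma eval2_move_monoms:
  assumes "\<And>i j. (i, j) \<in> supp P \<Longrightarrow>
    A * (s ^ i * t ^ j) = B * (s' ^ fst (h (i, j)) * t' ^ snd (h (i, j)))"
  shows "A * eval2 s t P = B * eval2 s' t' (move_monoms h P)"
proof -
  have "A * eval2 s t (move_monoms (\<lambda>x. x) P) = B * eval2 s' t' (move_monoms h P)"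
    unfolding move_monoms_def eval2_sum sum_distrib_left
  proof (intro sum.cong refl)
    fix x assume "x \<in> supp P"
    then show "A * eval2 s t (monom (monom (coeff (coeff P (snd x)) (fst x)) (fst x)) (snd x))
      = B * eval2 s' t' (monom (monom (coeff (coeff P (snd x)) (fst x)) (fst (h x))) (snd (h x)))"
      using assms[of "fst x" "snd x"] by (simp add: ac_simps)
  qed
  then show ?thesis by (simp only: move_monoms_id)
qed

text \<open>The restriction to the curve \<open>X_1 = 0\<close>, which later is an exceptional curve
  or the curve at infinity.\<close>

definition at_zero :: "'a::zero poly poly \<Rightarrow> 'a poly" where
  "at_zero P = map_poly (\<lambda>p. coeff p 0) P"

lemma coeff_at_zero [simp]: "coeff (at_zero P) j = coeff (coeff P j) 0"
  by (simp add: at_zero_def coeff_map_poly)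

lemma supp_at_zero: "(0, j) \<in> supp P \<longleftrightarrow> coeff (at_zero P) j \<noteq> 0"
  by (simp add: supp_def)

lemma at_zero_pCons: "at_zero (pCons p P) = pCons (coeff p 0) (at_zero P)"
  by (rule poly_eqI) (auto simp: coeff_pCons split: nat.splits)

lemma at_zero_add: "at_zero (P + Q) = at_zero P + at_zero Q" for P :: "'a::comm_monoid_add poly poly"
  by (rule poly_eqI) auto

lemma at_zero_shift:
  "at_zero (P \<circ>\<^sub>p [:[:c:], 1:]) = at_zero P \<circ>\<^sub>p [:c, 1:]" for c :: "'a::comm_ring_1"
proof (induction P)
  case 0
  then show ?case by (simp add: at_zero_def)
next
  case (pCons p P)
  have "at_zero ([:[:c:], 1:] * Q) = [:c, 1:] * at_zero Q" for Q
  proof -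
    have "at_zero (smult [:c:] Q) = smult c (at_zero Q)"
      by (rule poly_eqI) simp
    then show ?thesis by (simp add: at_zero_add at_zero_pCons)
  qed
  moreover have "at_zero [:p:] = [:coeff p 0:]"
    by (simp add: at_zero_pCons) (simp add: at_zero_def)
  ultimately show ?case
    using pCons.IH by (simp only: pcompose_pCons at_zero_pCons at_zero_add)
qed

lemma eval2_shift: "eval2 s t (P \<circ>\<^sub>p [:[:c:], 1:]) = eval2 s (t + scalar c) P"
  by (induction P) (auto simp: pcompose_pCons algebra_simps one_pCons)

lemma eval1_ord:
  assumes "ord_ge s 1"
  shows "ord_ge (eval1 s p) 0" "eval1 s p $$ 0 = fls_const (coeff p 0)"
proof -
  have *: "ord_ge (eval1 s p) 0" for p
  proof (induction p)
    case (pCons a p)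
    have "ord_ge (s * eval1 s p) (1 + 0)"
      by (intro ord_ge_mult assms pCons.IH)
    then have "ord_ge (s * eval1 s p) 0"
      by (rule ord_ge_mono) simp
    then show ?case by (simp add: ord_ge_add)
  qed simp
  show "ord_ge (eval1 s p) 0" by (rule *)
  show "eval1 s p $$ 0 = fls_const (coeff p 0)"
  proof (cases p)
    case (pCons a q)
    have "ord_ge (s * eval1 s q) (1 + 0)"
      by (intro ord_ge_mult assms *)
    then show ?thesis by (simp add: pCons ord_ge_def)
  qed
qed

text \<open>Modulo \<open>w\<close> the series \<open>s\<close> vanishes, so only the restriction of
  \<open>P\<close> to \<open>X_1 = 0\<close> contributes, taken at the residue of
  \<open>t\<close>.\<close>

lemma eval2_ord:
  assumes "ord_ge s 1" "ord_ge t 0"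
  shows "ord_ge (eval2 s t P) 0 \<and> eval2 s t P $$ 0 = poly (map_poly fls_const (at_zero P)) (t $$ 0)"
proof (induction P)
  case 0
  then show ?case by (simp add: at_zero_def)
next
  case (pCons p P)
  have "ord_ge (t * eval2 s t P) (0 + 0)"
    using assms pCons.IH by (intro ord_ge_mult) auto
  moreover have "(t * eval2 s t P) $$ (0 + 0) = t $$ 0 * eval2 s t P $$ 0"
    using assms pCons.IH by (intro mult_nth_lowest) auto
  ultimately show ?case
    using eval1_ord[OF assms(1), of p] pCons.IH
    by (simp add: at_zero_pCons map_poly_pCons ord_ge_add)
qed

text \<open>The terms of a polynomial in \<open>z\<close> have distinct orders once the order of
  \<open>z\<close> is nonzero, so they cannot cancel; subtracting the constant term of
  \<open>z\<close> reduces the remaining case to positive order.\<close>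

lemma fls_transcendental:
  fixes z :: "'a::field fls"
  assumes "\<nexists>c. z = fls_const c" "r \<noteq> 0"
  shows "poly (map_poly fls_const r) z \<noteq> 0"
proof -
  have neg: "poly (map_poly fls_const r) z \<noteq> 0 \<and>
      fls_subdegree (poly (map_poly fls_const r) z) = int (degree r) * fls_subdegree z"
    if "r \<noteq> 0" "fls_subdegree z < 0" for r and z :: "'a fls"
    using that(1)
  proof (induction r)
    case (pCons a r)
    show ?case
    proof (cases "r = 0")
      case True
      then show ?thesis using pCons by (auto simp: map_poly_pCons)
    next
      case False
      have "z \<noteq> 0" using that(2) by auto
      let ?w = "z * poly (map_poly fls_const r) z"
      have w: "?w \<noteq> 0" "fls_subdegree ?w = (int (degree r) + 1) * fls_subdegree z"
        using pCons.IH[OF False] \<open>z \<noteq> 0\<close> by (auto simp: algebra_simps)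
      have lt: "fls_subdegree ?w < 0"
        using w that(2) by (simp add: mult_pos_neg)
      have "fls_subdegree (fls_const a + ?w) = fls_subdegree ?w"
        using fls_subdegree_add_eq1[OF w(1), of "fls_const a"] lt by (simp add: add.commute)
      moreover have "fls_const a + ?w \<noteq> 0"
        using calculation lt by auto
      ultimately show ?thesis
        using w False by (simp add: map_poly_pCons)
    qed
  qed simp
  have pos: "poly (map_poly fls_const r) z \<noteq> 0"
    if "r \<noteq> 0" "z \<noteq> 0" "ord_ge z 1" for r and z :: "'a fls"
    using that(1)
  proof (induction r)
    case (pCons a r)
    have ge: "ord_ge (poly (map_poly fls_const r) z) 0" for r
    proof (induction r)
      case (pCons b r)
      have "ord_ge (z * poly (map_poly fls_const r) z) (1 + 0)"
        by (intro ord_ge_mult that pCons.IH)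
      then have "ord_ge (z * poly (map_poly fls_const r) z) 0"
        by (rule ord_ge_mono) simp
      then show ?case by (simp add: map_poly_pCons ord_ge_add)
    qed simp
    have "ord_ge (z * poly (map_poly fls_const r) z) (1 + 0)"
      by (intro ord_ge_mult that ge)
    then have c: "(fls_const a + z * poly (map_poly fls_const r) z) $$ 0 = a"
      by (simp add: ord_ge_def)
    show ?case
    proof (cases "a = 0")
      case True
      then show ?thesis using pCons that(2) by (auto simp: map_poly_pCons)
    next
      case False
      then have "fls_const a + z * poly (map_poly fls_const r) z \<noteq> 0"
        using c by (metis fls_zero_nth)
      then show ?thesis by (simp add: map_poly_pCons)
    qed
  qed simp
  show ?thesis
  proof (cases "fls_subdegree z < 0")
    case True
    then show ?thesis using neg assms by blast
  next
    case False
    define y where "y = z - fls_const (z $$ 0)"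
    have "y \<noteq> 0" using assms(1) by (auto simp: y_def)
    moreover have "ord_ge y 1"
      unfolding ord_ge_def y_def
      using False by auto
    moreover have "r \<circ>\<^sub>p [:z $$ 0, 1:] \<noteq> 0"
      using assms(2) pcompose_eq_0[of r "[:z $$ 0, 1:]"] by auto
    ultimately have "poly (map_poly fls_const (r \<circ>\<^sub>p [:z $$ 0, 1:])) y \<noteq> 0"
      by (intro pos)
    moreover have "poly (map_poly fls_const (r \<circ>\<^sub>p [:c, 1:])) y = poly (map_poly fls_const r) (y + fls_const c)" for c
    proof (induction r)
      case (pCons a r)
      have m: "map_poly fls_const (p + q) = map_poly fls_const p + map_poly fls_const q"
        "map_poly fls_const (smult b q) = smult (fls_const b) (map_poly fls_const q)" for p q :: "'a poly" and b
        by (rule poly_eqI, simp add: coeff_map_poly fls_plus_const)+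
      show ?case
        using pCons by (simp add: pcompose_pCons map_poly_pCons m algebra_simps)
    qed simp
    ultimately show ?thesis by (simp add: y_def)
  qed
qed

subsection \<open>The order of a polynomial in two elements\<close>

definition swap_vars :: "'a::comm_monoid_add poly poly \<Rightarrow> 'a poly poly" where
  "swap_vars = move_monoms prod.swap"

lemma eval2_swap_vars: "eval2 t s (swap_vars P) = eval2 s t P"
  using eval2_move_monoms[where h = prod.swap and A = 1 and B = 1 and P = P and s = s and t = t and s' = t and t' = s]
  by (simp add: swap_vars_def mult.commute)

lemma supp_swap_vars: "(j, i) \<in> supp (swap_vars P) \<longleftrightarrow> (i, j) \<in> supp P"
  unfolding swap_vars_def by (subst supp_move_monoms) force+

text \<open>Each blow-up of the point \<open>s = t = 0\<close> divides the bracket by the equation of the exceptional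
  curve, while the multiplicity of \<open>P\<close> does not grow.\<close>

lemma subdegree_eval2_le:
  fixes s t :: "'a::field fls fls"
  assumes "ord_ge s 1" "ord_ge t 1" "bracket s t \<noteq> 0" "(i, j) \<in> supp P" "i + j \<le> \<mu>"
  shows "eval2 s t P \<noteq> 0 \<and> fls_subdegree (eval2 s t P) \<le> int \<mu> * fls_subdegree (bracket s t)"
  using assms
proof (induction "nat (fls_subdegree (bracket s t))" arbitrary: s t P i j \<mu> rule: less_induct)
  case less
  define J where "J = nat (fls_subdegree (bracket s t))"
  have core: "eval2 s t P \<noteq> 0 \<and> fls_subdegree (eval2 s t P) \<le> int \<mu> * fls_subdegree (bracket s t)"
    if J: "J = nat (fls_subdegree (bracket s t))"
      and st: "ord_ge s 1" "ord_ge t 1" "bracket s t \<noteq> 0" "fls_subdegree s \<le> fls_subdegree t"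
      and ij: "(i, j) \<in> supp P" "i + j \<le> \<mu>"
    for s t :: "'a fls fls" and P i j
  proof -
    have nz: "s \<noteq> 0" "t \<noteq> 0" using st(3) by auto
    define m where "m = fls_subdegree s"
    have m1: "m \<ge> 1" using st(1) nz ord_ge_iff m_def by blast
    have mt: "ord_ge t m" using st(4) nz ord_ge_iff m_def by blast
    \<comment> \<open>\<open>\<mu>0\<close> is the exact multiplicity of \<open>P\<close> at the
      origin.\<close>
    define \<mu>0 where "\<mu>0 = (LEAST d. \<exists>x\<in>supp P. fst x + snd x = d)"
    have "\<exists>x\<in>supp P. fst x + snd x = \<mu>0"
      unfolding \<mu>0_def by (rule LeastI_ex) (use ij in auto)
    then obtain i0 j0 where ij0: "(i0, j0) \<in> supp P" "i0 + j0 = \<mu>0"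
      by auto
    have \<mu>0_le: "\<mu>0 \<le> a + b" if "(a, b) \<in> supp P" for a b
      unfolding \<mu>0_def by (rule Least_le) (use that in force)
    have "\<mu>0 \<le> \<mu>" using \<mu>0_le[OF ij(1)] ij(2) by simp
    define t1 where "t1 = t / s"
    have t: "t = s * t1" using nz by (simp add: t1_def)
    have t1: "ord_ge t1 0"
    proof -
      have "t1 \<noteq> 0" using nz t by auto
      then have "fls_subdegree t = m + fls_subdegree t1"
        using nz by (simp add: t m_def)
      then show ?thesis using \<open>t1 \<noteq> 0\<close> ord_ge_iff st(4) m_def by auto
    qed
    have br: "bracket s t = s * bracket s t1"
      by (simp add: t bracket_mult_right)
    have br_nz: "bracket s t1 \<noteq> 0" using st(3) br by auto
    have sub_br: "fls_subdegree (bracket s t) = m + fls_subdegree (bracket s t1)"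
      using nz br_nz by (simp add: br m_def)
    have br_ge: "fls_subdegree (bracket s t) \<ge> 2 * m - 1"
      using ord_ge_bracket[OF ord_ge_subdegree[of s] mt] st(3) ord_ge_iff m_def by force
    \<comment> \<open>With \<open>t = s * t1\<close> the monomial \<open>s ^ a * t ^ b\<close>
      becomes \<open>s ^ (a + b) * t1 ^ b\<close>; the common factor \<open>s ^ \<mu>0\<close> is
      split off.\<close>
    define h where "h = (\<lambda>x :: nat \<times> nat. (fst x + snd x - \<mu>0, snd x))"
    define P1 where "P1 = move_monoms h P"
    have inj: "inj_on h (supp P)"
      by (rule inj_onI) (auto simp: h_def dest!: \<mu>0_le)
    have P1: "eval2 s t P = s ^ \<mu>0 * eval2 s t1 P1"
    proof -
      have "1 * eval2 s t P = s ^ \<mu>0 * eval2 s t1 (move_monoms h P)"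
      proof (rule eval2_move_monoms)
        fix a b assume "(a, b) \<in> supp P"
        then have "s ^ (a + b) = s ^ \<mu>0 * s ^ (a + b - \<mu>0)"
          using \<mu>0_le by (simp flip: power_add)
        then show "1 * (s ^ a * t ^ b) = s ^ \<mu>0 * (s ^ fst (h (a, b)) * t1 ^ snd (h (a, b)))"
          by (simp add: h_def t power_mult_distrib power_add)
      qed
      then show ?thesis by (simp add: P1_def)
    qed
    \<comment> \<open>On the exceptional curve \<open>P1\<close> restricts to the dehomogenised
      lowest form of \<open>P\<close>. Its degree is at most \<open>\<mu>0\<close>, which bounds the
      multiplicity of \<open>P1\<close> at every point of the curve.\<close>
    have supp0: "coeff (at_zero P1) j0 \<noteq> 0"
      using ij0 unfolding supp_at_zero[symmetric] P1_def supp_move_monoms[OF inj]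
      by (force simp: h_def)
    have deg0: "degree (at_zero P1) \<le> \<mu>0"
    proof (rule degree_le, intro allI impI)
      fix l assume l: "\<mu>0 < l"
      show "coeff (at_zero P1) l = 0"
      proof (rule ccontr)
        assume "coeff (at_zero P1) l \<noteq> 0"
        then have "(0, l) \<in> h ` supp P"
          unfolding supp_at_zero[symmetric] P1_def supp_move_monoms[OF inj] .
        then show False using l by (auto simp: h_def dest: \<mu>0_le)
      qed
    qed
    have nz0: "at_zero P1 \<noteq> 0" using supp0 by (metis coeff_0)
    show ?thesis
    \<comment> \<open>The residue of \<open>t1\<close> is the point met on the exceptional curve. If
      it lies in \<open>K\<close>, it is moved to the origin and induction applies; otherwise it is
      transcendental over \<open>K\<close>, and the lowest form does not vanish there.\<close>
    proof (cases "\<exists>c. t1 $$ 0 = fls_const c")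
      case True
      then obtain c where c: "t1 $$ 0 = fls_const c" by auto
      define t2 where "t2 = t1 - scalar c"
      define P2 where "P2 = P1 \<circ>\<^sub>p [:[:c:], 1:]"
      have t2: "ord_ge t2 1"
        using t1 c by (auto simp: ord_ge_def t2_def)
      have e2: "eval2 s t2 P2 = eval2 s t1 P1"
        by (simp add: P2_def t2_def eval2_shift)
      have br2: "bracket s t2 = bracket s t1"
        by (simp add: t2_def)
      have "at_zero P2 \<noteq> 0" "degree (at_zero P2) \<le> \<mu>0"
        using nz0 deg0 pcompose_eq_0[of "at_zero P1" "[:c, 1:]"]
        by (auto simp: P2_def at_zero_shift degree_pcompose)
      then obtain j2 where j2: "(0, j2) \<in> supp P2" "j2 \<le> \<mu>0"
        using supp_at_zero leading_coeff_neq_0 by blast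
      have "fls_subdegree (bracket s t2) \<ge> 0"
        using ord_ge_bracket[OF st(1) t2] br_nz br2 ord_ge_iff by fastforce
      then have lt: "nat (fls_subdegree (bracket s t2)) < nat (fls_subdegree (bracket s t))"
        using sub_br m1 br2 by simp
      have IH: "eval2 s t2 P2 \<noteq> 0 \<and>
          fls_subdegree (eval2 s t2 P2) \<le> int \<mu>0 * fls_subdegree (bracket s t2)"
        by (rule less.hyps[of s t2 0 j2 P2]) (use lt J J_def st t2 br_nz br2 j2 in auto)
      have "fls_subdegree (eval2 s t P) = int \<mu>0 * m + fls_subdegree (eval2 s t2 P2)"
        using IH nz by (simp add: P1 e2 m_def fls_subdegree_pow)
      also have "\<dots> \<le> int \<mu>0 * fls_subdegree (bracket s t)"
        using IH by (simp add: sub_br br2 algebra_simps)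
      also have "\<dots> \<le> int \<mu> * fls_subdegree (bracket s t)"
        using \<open>\<mu>0 \<le> \<mu>\<close> br_ge m1 by (intro mult_right_mono) auto
      finally show ?thesis using IH nz e2 P1 by auto
    next
      case False
      have e: "ord_ge (eval2 s t1 P1) 0" "eval2 s t1 P1 $$ 0 \<noteq> 0"
        using eval2_ord[OF st(1) t1, of P1] fls_transcendental[OF _ nz0, of "t1 $$ 0"] False by auto
      then have e': "eval2 s t1 P1 \<noteq> 0" "fls_subdegree (eval2 s t1 P1) = 0"
        by (auto simp: ord_ge_def intro: fls_subdegree_eqI)
      have "fls_subdegree (eval2 s t P) = int \<mu>0 * m"
        using e' nz by (simp add: P1 m_def fls_subdegree_pow)
      \<comment> \<open>The bound \<open>br_ge\<close> suffices, since
        \<open>m \<le> 2 * m - 1\<close>.\<close>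
      also have "\<dots> \<le> int \<mu> * fls_subdegree (bracket s t)"
        using \<open>\<mu>0 \<le> \<mu>\<close> br_ge m1 by (intro mult_mono) auto
      finally show ?thesis using e' nz P1 by auto
    qed
  qed
  show ?case
  proof (cases "fls_subdegree s \<le> fls_subdegree t")
    case True
    then show ?thesis using core[OF J_def] less.prems by blast
  next
    case False
    have "eval2 t s (swap_vars P) \<noteq> 0 \<and>
        fls_subdegree (eval2 t s (swap_vars P)) \<le> int \<mu> * fls_subdegree (bracket t s)"
      by (rule core[of t s j i]) (use less.prems False in \<open>auto simp: J_def bracket_swap[of t s] supp_swap_vars\<close>)
    then show ?thesis
      by (simp add: eval2_swap_vars bracket_swap[of t s])
  qed
qed

section \<open>The toric chart at infinity\<close>

text \<open>The logarithmic derivative \<open>a * D x / x - b * D y / y\<close> of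
  \<open>x ^ a / y ^ b\<close>, cleared of denominators.\<close>

lemma derivation_monomial:
  fixes x y :: "'b::field"
  assumes D: "\<And>u v. D (u * v) = u * D v + D u * v" and nz: "x \<noteq> 0" "y \<noteq> 0"
  shows "x * y * D (x ^ a / y ^ b) = x ^ a / y ^ b * (of_nat a * y * D x - of_nat b * x * D y)"
proof -
  have "D 1 + 0 = D 1 + D 1" using D[of 1 1] by (simp only: mult_1 mult_1_right add_0_right)
  then have D1: "D 1 = 0" by (simp only: add_left_cancel)
  have pow: "u * D (u ^ n) = of_nat n * u ^ n * D u" for u n
    by (induction n) (simp_all add: D D1 algebra_simps)
  define E where "E = x ^ a / y ^ b"
  have E: "x ^ a = E * y ^ b" using nz by (simp add: E_def)
  have "y ^ b * (x * y * D E) = y * (x * D (E * y ^ b)) - E * x * (y * D (y ^ b))"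
    by (simp add: D algebra_simps)
  also have "\<dots> = y * (of_nat a * (E * y ^ b) * D x) - E * x * (of_nat b * y ^ b * D y)"
    using pow[of x a] by (simp only: pow E)
  also have "\<dots> = y ^ b * (E * (of_nat a * y * D x - of_nat b * x * D y))"
    by (simp add: algebra_simps)
  finally show ?thesis
    using nz by (simp add: E_def[symmetric])
qed

text \<open>In logarithmic form a monomial change of coordinates multiplies the bracket by the
  determinant of the exponents. Here that is \<open>p * b - q * a = 1\<close>, so the bracket
  survives in every characteristic.\<close>

lemma bracket_monomials:
  assumes nz: "x \<noteq> 0" "y \<noteq> 0" and ab: "p * b = q * a + 1"
  shows "x * y * bracket (x ^ a / y ^ b) (x ^ p / y ^ q) = (x ^ a / y ^ b) * (x ^ p / y ^ q) * bracket x y"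
proof -
  define E T where "E = x ^ a / y ^ b" and "T = x ^ p / y ^ q"
  note d = derivation_monomial[where D = deriv_coeffs, OF deriv_coeffs_mult nz]
  note d' = derivation_monomial[where D = fls_deriv, OF fls_deriv_mult nz]
  have ab': "of_nat p * of_nat b = of_nat q * of_nat a + (1 :: 'a fls fls)"
    using ab by (metis of_nat_1 of_nat_add of_nat_mult)
  have "(x * y) * (x * y * bracket E T) =
    (x * y * deriv_coeffs E) * (x * y * fls_deriv T) - (x * y * fls_deriv E) * (x * y * deriv_coeffs T)"
    by (simp add: bracket_def algebra_simps)
  also have "\<dots> = E * T * (x * y) * (of_nat p * of_nat b - of_nat q * of_nat a) * bracket x y"
    unfolding E_def T_def d d' by (simp only: bracket_def) (simp only: algebra_simps)
  also have "\<dots> = (x * y) * (E * T * bracket x y)"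
    by (simp add: ab')
  finally have "x * y * bracket E T = E * T * bracket x y"
    using nz by (simp only: mult_left_cancel mult_eq_0_iff not_False_eq_True simp_thms)
  then show ?thesis
    by (simp only: E_def T_def)
qed

text \<open>\<open>g\<close> is a power of the variable times a polynomial of degree at most
  \<open>\<mu>\<close>, so a nonzero \<open>c\<close> is a root of multiplicity at most
  \<open>\<mu>\<close>.\<close>

lemma coeff_shift_nonzero:
  fixes g :: "'a::field poly"
  assumes "g \<noteq> 0" "c \<noteq> 0" "\<And>l. coeff g l \<noteq> 0 \<Longrightarrow> s \<le> l \<and> l \<le> s + \<mu>"
  shows "\<exists>j\<le>\<mu>. coeff (g \<circ>\<^sub>p [:c, 1:]) j \<noteq> 0"
proof (rule ccontr)
  assume neg: "\<not> ?thesis"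
  define r where "r = poly_shift s g"
  have g: "g = monom 1 s * r"
    by (rule poly_eqI) (use assms(3) in \<open>force simp: r_def coeff_monom_mult coeff_poly_shift\<close>)
  have r: "r \<noteq> 0" using g assms(1) by auto
  have "degree r \<le> \<mu>"
  proof (rule degree_le, intro allI impI)
    fix l assume "\<mu> < l"
    then show "coeff r l = 0" using assms(3)[of "l + s"] by (auto simp: r_def coeff_poly_shift)
  qed
  have "monom 1 (Suc \<mu>) dvd g \<circ>\<^sub>p [:c, 1:]"
    using neg by (auto simp: monom_1_dvd_iff' less_Suc_eq_le)
  then obtain k where k: "g \<circ>\<^sub>p [:c, 1:] = monom 1 (Suc \<mu>) * k" by (elim dvdE)
  have "g = (g \<circ>\<^sub>p [:c, 1:]) \<circ>\<^sub>p [:- c, 1:]"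
    by (simp add: pcompose_assoc[symmetric] pcompose_pCons)
  also have "\<dots> = [:- c, 1:] ^ Suc \<mu> * (k \<circ>\<^sub>p [:- c, 1:])"
  proof -
    have "monom 1 n \<circ>\<^sub>p q = q ^ n" for n and q :: "'a poly"
      by (induction n) (simp_all add: monom_0 monom_Suc pcompose_pCons one_pCons)
    then show ?thesis unfolding k by (simp only: pcompose_mult)
  qed
  finally have "[:- c, 1:] ^ Suc \<mu> dvd g" by (metis dvd_triv_left)
  then have "Suc \<mu> \<le> order c g"
    using assms(1) by (simp only: order_divides) simp
  also have "order c g = order c (monom 1 s) + order c r"
    using assms(1) g order_mult by metis
  also have "order c (monom 1 s) = 0"
    using assms(2) by (intro order_0I) (simp add: poly_monom)
  finally show False
    using order_degree[OF r, of c] \<open>degree r \<le> \<mu>\<close> by simp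
qed

text \<open>The valuation is studied in the toric chart \<open>x = E\<^bsup>-q\<^esup> T\<^bsup>b\<^esup>\<close>, \<open>y = E\<^bsup>-p\<^esup> T\<^bsup>a\<^esup>\<close>, in which \<open>E = 0\<close>
  is the curve at infinity of weight \<open>(q, p)\<close>.\<close>

lemma weights_at_infinity:
  fixes x y :: "'a::field fls fls"
  assumes nz: "x \<noteq> 0" "y \<noteq> 0" and pos: "p > 0" "q > 0" "N > 0" and cop: "coprime p q"
    and sub: "fls_subdegree x = - int (q * N)" "fls_subdegree y = - int (p * N)"
    and br: "bracket x y \<noteq> 0" "fls_subdegree (bracket x y) = - 2"
    and f: "(i1, j1) \<in> supp f" "(i1, j1) \<noteq> (0, 0)" "ord_ge (eval2 x y f) 0"
  shows "p * q \<le> p + q" "\<exists>c. c \<noteq> 0 \<and> ord_ge (x ^ p - scalar c * y ^ q) (1 - int (p * q * N))"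
proof -
  obtain b a where ab: "p * b = q * a + 1"
    using bezout_nat[of p q] pos cop by auto
  have ab': "int p * int b = int q * int a + 1"
    using ab by (metis of_nat_1 of_nat_add of_nat_mult)
  \<comment> \<open>The Bezout relation gives \<open>E\<close> order \<open>N\<close>, while the
    weights cancel in \<open>T\<close>, which has order 0.\<close>
  define E T where "E = x ^ a / y ^ b" and "T = x ^ p / y ^ q"
  have ET: "E \<noteq> 0" "T \<noteq> 0" using nz by (auto simp: E_def T_def)
  have T: "x ^ p = T * y ^ q" and E: "x ^ a = E * y ^ b"
    using nz by (auto simp: E_def T_def)
  have subT: "fls_subdegree T = 0"
  proof -
    have "fls_subdegree (x ^ p) = fls_subdegree T + fls_subdegree (y ^ q)"
      unfolding T using nz ET by simp
    then show ?thesis by (simp add: fls_subdegree_pow sub algebra_simps)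
  qed
  have subE: "fls_subdegree E = int N"
  proof -
    have "fls_subdegree (x ^ a) = fls_subdegree E + fls_subdegree (y ^ b)"
      unfolding E using nz ET by simp
    then have "fls_subdegree E = int N * (int p * int b - int q * int a)"
      by (simp add: fls_subdegree_pow sub algebra_simps)
    then show ?thesis by (simp add: ab')
  qed
  have brET: "x * y * bracket E T = E * T * bracket x y"
    unfolding E_def T_def by (rule bracket_monomials[OF nz ab])
  have brET_nz: "bracket E T \<noteq> 0"
    using brET br ET nz by auto
  have subbr: "fls_subdegree (bracket E T) = int N * (int p + int q + 1) - 2"
  proof -
    have "fls_subdegree (x * y * bracket E T) = fls_subdegree (E * T * bracket x y)"
      by (simp only: brET)
    then show ?thesis using nz ET br brET_nz by (simp add: sub subE subT algebra_simps)
  qed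
  have xE: "x * E ^ q = T ^ b"
  proof -
    have "x * E ^ q = x ^ (q * a + 1) / y ^ (q * b)"
      by (simp add: E_def power_divide power_mult[symmetric] mult.commute)
    also have "\<dots> = T ^ b"
      unfolding ab[symmetric] by (simp only: T_def power_divide power_mult[symmetric])
    finally show ?thesis .
  qed
  have yE: "y * E ^ p = T ^ a"
  proof -
    have "y * E ^ p = y * x ^ (a * p) / y ^ (q * a + 1)"
      unfolding ab[symmetric] by (simp add: E_def power_divide power_mult[symmetric] mult.commute)
    also have "\<dots> = T ^ a"
      using nz by (simp add: T_def power_divide power_mult[symmetric] mult.commute)
    finally show ?thesis .
  qed
  \<comment> \<open>\<open>W\<close> is the weighted degree of \<open>f\<close>, hence the power of
    \<open>E\<close> that clears the denominators of \<open>f\<close> in the chart.\<close>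
  define W where "W = Max ((\<lambda>(i, j). q * i + p * j) ` supp f)"
  have W_ge: "q * i + p * j \<le> W" if "(i, j) \<in> supp f" for i j
    unfolding W_def using that by (intro Max_ge) force+
  have "W \<in> (\<lambda>(i, j). q * i + p * j) ` supp f"
    unfolding W_def by (rule Max_in) (use f in auto)
  then obtain i2 j2 where ij2: "(i2, j2) \<in> supp f" "q * i2 + p * j2 = W" by auto
  have W_pos: "W > 0"
    using W_ge[OF f(1)] f(2) pos by (cases "i1 = 0") (auto intro: gr0I)
  define h where "h = (\<lambda>(i, j). (W - (q * i + p * j), b * i + a * j))"
  define P where "P = move_monoms h f"
  have inj: "inj_on h (supp f)"
  proof (rule inj_onI, clarify)
    fix i j i' j' assume ij: "(i, j) \<in> supp f" "(i', j') \<in> supp f" "h (i, j) = h (i', j')"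
    have eq: "q * i + p * j = q * i' + p * j'" "b * i + a * j = b * i' + a * j'"
      using ij W_ge[OF ij(1)] W_ge[OF ij(2)] by (auto simp: h_def)
    have *: "int i = int p * int (b * i + a * j) - int a * int (q * i + p * j)"
      "int j = int b * int (q * i + p * j) - int q * int (b * i + a * j)" for i j
    proof -
      have "int p * int (b * i + a * j) - int a * int (q * i + p * j) = (int p * int b - int q * int a) * int i"
        "int b * int (q * i + p * j) - int q * int (b * i + a * j) = (int p * int b - int q * int a) * int j"
        by (simp_all add: algebra_simps)
      then show "int i = int p * int (b * i + a * j) - int a * int (q * i + p * j)"
        "int j = int b * int (q * i + p * j) - int q * int (b * i + a * j)"
        by (simp_all add: ab')
    qed
    show "i = i' \<and> j = j'"
      using *(1)[of i j] *(1)[of i' j'] *(2)[of j i] *(2)[of j' i'] eq by (metis of_nat_eq_iff)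
  qed
  have eval: "E ^ W * eval2 x y f = eval2 E T P"
  proof -
    have "E ^ W * eval2 x y f = 1 * eval2 E T (move_monoms h f)"
    proof (rule eval2_move_monoms)
      fix i j assume "(i, j) \<in> supp f"
      then have "E ^ W = E ^ (W - (q * i + p * j)) * (E ^ (q * i) * E ^ (p * j))"
        using W_ge by (simp flip: power_add)
      then have "E ^ W * (x ^ i * y ^ j) = E ^ (W - (q * i + p * j)) * ((x * E ^ q) ^ i * (y * E ^ p) ^ j)"
        by (simp only: power_mult power_mult_distrib) (simp only: ac_simps)
      then show "E ^ W * (x ^ i * y ^ j) = 1 * (E ^ fst (h (i, j)) * T ^ snd (h (i, j)))"
        by (simp add: xE yE h_def power_add power_mult)
    qed
    then show ?thesis by (simp add: P_def)
  qed
  \<comment> \<open>On \<open>E = 0\<close> only the part of \<open>f\<close> of top weight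
    survives.\<close>
  have supp0: "coeff (at_zero P) l \<noteq> 0 \<longleftrightarrow> (\<exists>i j. (i, j) \<in> supp f \<and> q * i + p * j = W \<and> l = b * i + a * j)" for l
    unfolding supp_at_zero[symmetric] P_def supp_move_monoms[OF inj]
    using W_ge by (force simp: h_def)
  have nz0: "at_zero P \<noteq> 0"
    using supp0 ij2 by (metis coeff_0)
  have E1: "ord_ge E 1"
    using subE ET pos by (subst ord_ge_iff) auto
  have T0: "ord_ge T 0"
    using subT ET by (subst ord_ge_iff) auto
  have ord_eval: "ord_ge (eval2 E T P) (int (W * N))"
  proof -
    have "ord_ge (E ^ W) (int (W * N))"
      using ET by (subst ord_ge_iff) (auto simp: fls_subdegree_pow subE)
    then show ?thesis
      using ord_ge_mult[OF _ f(3), of "E ^ W"] eval by fastforce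
  qed
  \<comment> \<open>As \<open>E ^ W * eval2 x y f\<close> has positive order, the residue of
    \<open>T\<close> is a root of the nonzero polynomial \<open>at_zero P\<close>; being algebraic
    over \<open>K\<close>, it is constant.\<close>
  have "\<exists>c. T $$ 0 = fls_const c"
  proof (rule ccontr)
    assume "\<not> ?thesis"
    then have "eval2 E T P $$ 0 \<noteq> 0"
      using eval2_ord[OF E1 T0, of P] fls_transcendental[OF _ nz0, of "T $$ 0"] by auto
    then show False
      using ord_eval W_pos pos by (auto simp: ord_ge_def)
  qed
  then obtain c where c: "T $$ 0 = fls_const c" by auto
  have "c \<noteq> 0"
    using c ET subT nth_fls_subdegree_nonzero[of T] by auto
  have Tc: "ord_ge (T - scalar c) 1"
    using T0 c by (auto simp: ord_ge_def)
  have "x ^ p - scalar c * y ^ q = (T - scalar c) * y ^ q"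
    by (simp add: T algebra_simps)
  moreover have "ord_ge (y ^ q) (- int (p * q * N))"
    using nz by (subst ord_ge_iff) (auto simp: fls_subdegree_pow sub)
  ultimately have "ord_ge (x ^ p - scalar c * y ^ q) (1 - int (p * q * N))"
    using ord_ge_mult[OF Tc, of "y ^ q"] by fastforce
  then show "\<exists>c. c \<noteq> 0 \<and> ord_ge (x ^ p - scalar c * y ^ q) (1 - int (p * q * N))"
    using \<open>c \<noteq> 0\<close> by auto

  \<comment> \<open>The pairs with \<open>q * i + p * j = W\<close> lie on a progression with step
    \<open>(p, - q)\<close>, along which the exponent \<open>b * i + a * j\<close> of
    \<open>T\<close> grows by 1. Since \<open>i\<close> and \<open>j\<close> are nonnegative, the
    exponents of \<open>at_zero P\<close> span at most \<open>W div (p * q)\<close>.\<close>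
  define \<mu> where "\<mu> = W div (p * q)"
  define P2 where "P2 = P \<circ>\<^sub>p [:[:c:], 1:]"
  define s where "s = (LEAST l. coeff (at_zero P) l \<noteq> 0)"
  have "coeff (at_zero P) s \<noteq> 0"
    unfolding s_def by (rule LeastI_ex) (use nz0 in \<open>auto simp: poly_eq_iff\<close>)
  then obtain i0 j0 where s: "q * i0 + p * j0 = W" "s = b * i0 + a * j0"
    using supp0 by blast
  have "s \<le> l \<and> l \<le> s + \<mu>" if l: "coeff (at_zero P) l \<noteq> 0" for l
  proof -
    have "s \<le> l" unfolding s_def using l by (rule Least_le)
    obtain i j where ij: "q * i + p * j = W" "l = b * i + a * j"
      using l supp0 by blast
    have e: "int q * (int i - int i0) = int p * (int j0 - int j)"
    proof -
      have "int (q * i + p * j) = int (q * i0 + p * j0)" using ij s by simp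
      then show ?thesis by (simp add: algebra_simps)
    qed
    have "int p dvd int q * (int i - int i0)" by (simp add: e)
    then have "int p dvd int i - int i0"
      using cop by (simp add: coprime_dvd_mult_right_iff)
    then obtain k where k: "int i - int i0 = int p * k" by (elim dvdE)
    have "int p * (int j0 - int j) = int p * (int q * k)"
      unfolding e[symmetric] k by (simp only: ac_simps)
    then have k': "int j0 - int j = int q * k"
      using pos by simp
    have "int l - int s = int b * (int i - int i0) - int a * (int j0 - int j)"
      by (simp add: ij s algebra_simps)
    also have "\<dots> = (int p * int b - int q * int a) * k"
      by (simp add: k k' algebra_simps)
    finally have lk: "int l - int s = k" by (simp add: ab')
    have "int q * k \<le> int j0" using k' by simp
    then have "int p * (int q * k) \<le> int p * int j0"
      by (intro mult_left_mono) auto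
    also have "\<dots> \<le> int W" unfolding s(1)[symmetric] by simp
    finally have "k * int (p * q) \<le> int W" by (simp add: ac_simps)
    moreover have "k \<ge> 0" using lk \<open>s \<le> l\<close> by simp
    ultimately have "nat k * (p * q) \<le> W"
      by (metis nat_int nat_le_iff nat_mult_distrib zero_le_mult_iff of_nat_0_le_iff)
    then have "nat k \<le> \<mu>"
      unfolding \<mu>_def using pos by (simp add: less_eq_div_iff_mult_less_eq)
    then show ?thesis using lk \<open>s \<le> l\<close> by linarith
  qed
  then obtain j where j: "j \<le> \<mu>" "coeff (at_zero P \<circ>\<^sub>p [:c, 1:]) j \<noteq> 0"
    using coeff_shift_nonzero[OF nz0 \<open>c \<noteq> 0\<close>] by meson
  have "(0, j) \<in> supp P2"
    unfolding supp_at_zero P2_def at_zero_shift by (rule j)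
  moreover have "eval2 E (T - scalar c) P2 = eval2 E T P"
    by (simp add: P2_def eval2_shift)
  ultimately have "eval2 E T P \<noteq> 0 \<and> fls_subdegree (eval2 E T P) \<le> int \<mu> * fls_subdegree (bracket E T)"
    using subdegree_eval2_le[OF E1 Tc, of 0 j P2 \<mu>] brET_nz j by simp
  then have "int (W * N) \<le> int \<mu> * (int N * (int p + int q + 1) - 2)"
    using ord_eval ord_ge_iff subbr by fastforce
  moreover have "int \<mu> * (int p * int q * int N) \<le> int (W * N)"
  proof -
    have "\<mu> * (p * q) * N \<le> W * N" unfolding \<mu>_def by simp
    then show ?thesis by (metis of_nat_mono of_nat_mult mult.assoc)
  qed
  moreover have "\<mu> > 0"
  proof (rule gr0I)
    assume "\<mu> = 0"
    then have "W * N \<le> 0"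
      using calculation(1) by (simp only: of_nat_0 mult_zero_left of_nat_le_0_iff)
    then show False using W_pos pos by simp
  qed
  \<comment> \<open>As \<open>\<mu> * p * q \<le> W\<close>, the factor \<open>\<mu> > 0\<close>
    cancels from the combined bounds.\<close>
  ultimately have "int p * int q * int N \<le> int N * (int p + int q + 1) - 2"
    by (smt (verit) mult_less_cancel_left_pos of_nat_0_less_iff)
  \<comment> \<open>The summand \<open>- 2\<close> makes the inequality strict, which removes the 1
    from \<open>p + q + 1\<close>.\<close>
  then have "int N * (int p * int q) < int N * (int p + int q + 1)"
    by (simp add: algebra_simps)
  then have "int p * int q < int p + int q + 1"
    using pos by (simp add: mult_less_cancel_left_pos)
  then show "p * q \<le> p + q"
    by (metis of_nat_add of_nat_mult of_nat_le_iff zle_add1_eq_le)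
qed

subsection \<open>The theorem of Jung and van der Kulk\<close>

definition laurent1 :: "'a::field poly \<Rightarrow> 'a fls" where
  "laurent1 p = poly (map_poly fls_const p) fls_X"

text \<open>\<open>K[X\<^sub>1,X\<^sub>2]\<close> inside \<open>K((u))((w))\<close> with \<open>X\<^sub>1 = u\<close> and \<open>X\<^sub>2 = 1/w\<close>, so that the order in \<open>w\<close> is minus the
  degree in \<open>X\<^sub>2\<close>.\<close>
definition laurent :: "'a::field bipoly \<Rightarrow> 'a fls fls" where
  "laurent P = eval2 (fls_const fls_X) fls_X_inv P"

lemma laurent1_nth: "laurent1 p $$ n = (if n < 0 then 0 else coeff p (nat n))"
proof (induction p arbitrary: n)
  case (pCons a p)
  have "laurent1 (pCons a p) $$ n = (if n = 0 then a else 0) + laurent1 p $$ (n - 1)"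
    by (simp add: laurent1_def map_poly_pCons fls_X_times_conv_shift)
  then show ?case
    using pCons.IH by (auto simp: coeff_pCons nat_diff_distrib split: nat.splits)
qed (simp add: laurent1_def)

lemma laurent1_0_iff: "laurent1 p = 0 \<longleftrightarrow> p = 0"
proof
  assume "laurent1 p = 0"
  then have "coeff p n = 0" for n
    using laurent1_nth[of p "int n"] by simp
  then show "p = 0" by (simp add: poly_eq_iff)
qed (simp add: laurent1_def)

lemma eval1_laurent1: "eval1 (fls_const fls_X) p = fls_const (laurent1 p)"
  by (induction p) (auto simp: laurent1_def map_poly_pCons scalar_def fls_plus_const)

lemma laurent_nth: "laurent P $$ n = (if n > 0 then 0 else laurent1 (coeff P (nat (- n))))"
proof (induction P arbitrary: n)
  case 0
  then show ?case by (simp add: laurent_def laurent1_def)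
next
  case (pCons p P)
  have "laurent (pCons p P) $$ n = (if n = 0 then laurent1 p else 0) + laurent P $$ (n + 1)"
    by (simp add: laurent_def fls_X_inv_times_conv_shift eval1_laurent1)
  moreover have "nat (- n) = Suc (nat (- (n + 1)))" if "n < 0"
    using that by simp
  ultimately show ?case
    using pCons.IH by (cases "n < 0") (auto simp: coeff_pCons)
qed

lemma laurent_subdegree:
  assumes "P \<noteq> 0"
  shows "laurent P \<noteq> 0" "fls_subdegree (laurent P) = - int (degree P)"
proof -
  have "laurent P $$ (- int (degree P)) \<noteq> 0"
    using assms by (simp add: laurent_nth laurent1_0_iff)
  moreover have "laurent P $$ k = 0" if "k < - int (degree P)" for k
  proof -
    have "coeff P (nat (- k)) = 0" by (rule coeff_eq_0) (use that in linarith)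
    then show ?thesis by (simp add: laurent_nth laurent1_def)
  qed
  ultimately show "laurent P \<noteq> 0" "fls_subdegree (laurent P) = - int (degree P)"
    by (auto intro: fls_subdegree_eqI)
qed

lemma laurent_hom [simp]:
  "laurent (P + Q) = laurent P + laurent Q" "laurent (P * Q) = laurent P * laurent Q" "laurent (bconst a) = scalar a"
  by (simp_all add: laurent_def bconst_def)

lemma laurent_minus [simp]: "laurent (- P) = - laurent P"
proof -
  have "laurent P + laurent (- P) = laurent (bconst 0)"
    by (simp flip: laurent_hom(1))
  then show ?thesis by (simp add: eq_neg_iff_add_eq_0 add.commute del: bconst_simps)
qed

lemma laurent_diff [simp]: "laurent (P - Q) = laurent P - laurent Q"
  using laurent_hom(1)[of P "- Q"] by simp

lemma laurent_power [simp]: "laurent (P ^ n) = laurent P ^ n"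
  by (induction n) (simp_all, simp add: laurent_def one_pCons)

lemma eval2_laurent: "eval2 (laurent (F $ 1)) (laurent (F $ 2)) P = laurent (subst P F)"
proof (induction P rule: bipoly_induct)
  case (const a)
  then show ?case by (simp add: bconst_def[of a]) (simp flip: bconst_def)
next
  case (var i)
  have "eval2 s t (Xs $ 1) = s" "eval2 s t (Xs $ 2) = t" for s t :: "'a fls fls"
    by (simp_all add: Xs_def one_pCons)
  then show ?case using exhaust_2[of i] by auto
qed auto

lemma deriv_coeffs_laurent: "deriv_coeffs (laurent P) = laurent (partial_deriv 1 P)"
proof (rule fls_eqI)
  fix n
  have "fls_deriv (laurent1 p) = laurent1 (pderiv p)" for p :: "'a poly"
  proof (rule fls_eqI)
    fix m
    show "fls_deriv (laurent1 p) $$ m = laurent1 (pderiv p) $$ m"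
      by (cases "m = - 1") (auto simp: laurent1_nth coeff_pderiv nat_add_distrib)
  qed
  then show "deriv_coeffs (laurent P) $$ n = laurent (partial_deriv 1 P) $$ n"
    by (simp add: laurent_nth partial_deriv_def coeff_map_poly)
qed

text \<open>The chain rule for \<open>X_2 = 1 / w\<close>, whose derivative in \<open>w\<close> is
  \<open>- 1 / w^2\<close>.\<close>

lemma fls_deriv_laurent: "fls_deriv (laurent P) = - (fls_X_inv ^ 2 * laurent (partial_deriv 2 P))"
proof (rule fls_eqI)
  fix n
  have e: "laurent1 (of_nat k * p) = of_nat k * laurent1 p" for k and p :: "'a poly"
  proof (rule fls_eqI)
    fix m
    have "of_nat k * p = smult (of_nat k) p" by (simp add: of_nat_poly)
    moreover have "of_nat k * laurent1 p = fls_const (of_nat k) * laurent1 p"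
      by (simp add: fls_of_nat)
    ultimately show "laurent1 (of_nat k * p) $$ m = (of_nat k * laurent1 p) $$ m"
      by (simp add: laurent1_nth)
  qed
  show "fls_deriv (laurent P) $$ n = (- (fls_X_inv ^ 2 * laurent (partial_deriv 2 P))) $$ n"
  proof (cases "n \<le> - 2")
    case True
    define k where "k = nat (- n - 2)"
    have n: "n + 1 = - int (Suc k)" "n + 2 = - int k"
      using True by (auto simp: k_def)
    have "fls_deriv (laurent P) $$ n = - of_nat (Suc k) * laurent1 (coeff P (Suc k))"
      unfolding fls_deriv_nth n by (simp add: laurent_nth nat_add_distrib)
    also have "\<dots> = - laurent1 (coeff (pderiv P) k)"
      by (simp only: coeff_pderiv e mult_minus_left)
    also have "\<dots> = - (laurent (partial_deriv 2 P) $$ (n + 2))"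
      unfolding n by (simp add: laurent_nth partial_deriv_def)
    finally show ?thesis
      by (simp add: fls_X_inv_power_times_conv_shift)
  next
    \<comment> \<open>For \<open>n = - 1\<close> the derivative carries the factor
      \<open>n + 1 = 0\<close>; all other coefficients involved belong to positive powers of
      \<open>w\<close>, which do not occur.\<close>
    case False
    then show ?thesis
      by (cases "n = - 1") (auto simp: fls_X_inv_power_times_conv_shift laurent_nth)
  qed
qed

lemma bracket_laurent:
  "bracket (laurent P) (laurent Q) = - (fls_X_inv ^ 2 * laurent (jacobian P Q))"
  by (simp add: bracket_def deriv_coeffs_laurent fls_deriv_laurent jacobian_def algebra_simps)

section \<open>Automorphisms whose first component is free of \<open>X_2\<close>\<close>

lemma upoly_conv_pcompose: "upoly p Q = map_poly (\<lambda>a. [:a:]) p \<circ>\<^sub>p Q"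
  by (induction p) (auto simp: map_poly_pCons pcompose_pCons bconst_def)

lemma degree_upoly: "degree (upoly p Q) = degree p * degree Q"
  by (simp add: upoly_conv_pcompose degree_pcompose degree_map_poly)

lemma upoly_const: "upoly p [:q:] = [:p \<circ>\<^sub>p q:]"
  by (induction p) (auto simp: bconst_def pcompose_pCons)

lemma subst_const_poly: "subst [:p:] F = upoly p (F $ 1)"
  by (simp add: subst_def upoly_def map_poly_pCons)

lemma subst_pCons: "subst (pCons p P) F = upoly p (F $ 1) + F $ 2 * subst P F"
  by (simp add: subst_def upoly_def map_poly_pCons)

lemma subst_conv_pcompose:
  assumes "F $ 1 = [:q:]"
  shows "subst P F = map_poly (\<lambda>p. p \<circ>\<^sub>p q) P \<circ>\<^sub>p (F $ 2)"
  by (induction P) (auto simp: subst_pCons map_poly_pCons pcompose_pCons assms upoly_const)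

text \<open>Comparing degrees in \<open>X_2\<close> in \<open>r(G_1) = X_1\<close> makes
  \<open>G_1\<close> a polynomial in \<open>X_1\<close>, so both it and \<open>r\<close> have degree
  1. The same comparison for the second component makes \<open>F_2\<close> linear in
  \<open>X_2\<close>, with a leading coefficient that becomes a unit after substituting
  \<open>G_1\<close>.\<close>

lemma automorphism_degree_0:
  fixes F :: "'a::field polymap"
  assumes "poly_automorphism F" "degree (F $ 1) = 0"
  obtains \<alpha> \<beta> \<gamma> h where "\<alpha> \<noteq> 0" "\<gamma> \<noteq> 0" "F = pair_map [:[:\<beta>, \<alpha>:]:] [:h, [:\<gamma>:]:]"
proof -
  obtain G where "pmcomp F G = Xs"
    using assms by (auto simp: poly_automorphism_def)
  then have s: "subst (F $ i) G = Xs $ i" for i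
    by (metis pmcomp_def vec_lambda_beta)
  obtain r where r: "F $ 1 = [:r:]"
    using assms(2) degree_eq_zeroE by blast
  have u: "upoly r (G $ 1) = [:[:0, 1:]:]"
    using s[of 1] by (simp add: r subst_const_poly) (simp add: Xs_def)
  then have "degree r * degree (G $ 1) = 0"
    using degree_upoly[of r "G $ 1"] by simp
  moreover have "degree r \<noteq> 0"
  proof
    assume "degree r = 0"
    then obtain b where "r = [:b:]" using degree_eq_zeroE by blast
    then show False using u by (simp add: bconst_def)
  qed
  ultimately obtain g where g: "G $ 1 = [:g:]"
    using degree_eq_zeroE by auto
  have "degree r * degree g = 1"
    using u degree_pcompose[of r g] by (simp add: g upoly_const)
  then have deg: "degree r = 1" "degree g = 1" by auto
  then obtain \<alpha> \<beta> where \<alpha>: "r = [:\<beta>, \<alpha>:]" "\<alpha> \<noteq> 0"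
    using degree1_coeffs by (metis One_nat_def)
  let ?P = "map_poly (\<lambda>p. p \<circ>\<^sub>p g) (F $ 2)"
  have P: "?P \<circ>\<^sub>p (G $ 2) = [:0, 1:]"
    using s[of 2] by (simp add: subst_conv_pcompose[OF g]) (simp add: Xs_def)
  have nz: "p \<circ>\<^sub>p g \<noteq> 0" if "p \<noteq> 0" for p
    using that deg pcompose_eq_0[of p g] by auto
  have "degree ?P * degree (G $ 2) = 1"
    using P degree_pcompose[of ?P "G $ 2"] by simp
  moreover have "degree ?P = degree (F $ 2)"
    using nz by (cases "F $ 2 = 0") (auto intro: map_poly_degree_eq)
  ultimately have "degree (F $ 2) = 1" "degree (G $ 2) = 1" by auto
  then obtain h c where F2: "F $ 2 = [:h, c:]" and c: "c \<noteq> 0"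
    using degree1_coeffs by (metis One_nat_def)
  have "[:h \<circ>\<^sub>p g, c \<circ>\<^sub>p g:] \<circ>\<^sub>p (G $ 2) = [:0, 1:]"
    using P c by (simp add: F2 map_poly_pCons)
  then have "coeff ([:h \<circ>\<^sub>p g:] + G $ 2 * [:c \<circ>\<^sub>p g:]) 1 = 1"
    by (simp add: pcompose_pCons)
  then have "(c \<circ>\<^sub>p g) * coeff (G $ 2) 1 = 1"
    by (simp add: mult.commute[of "G $ 2"])
  then have "c \<circ>\<^sub>p g dvd 1" by (metis dvd_triv_left)
  then have "degree (c \<circ>\<^sub>p g) = 0" by (auto simp: is_unit_poly_iff)
  then have "degree c = 0" using deg degree_pcompose[of c g] by simp
  then obtain \<gamma> where \<gamma>: "c = [:\<gamma>:]" using degree_eq_zeroE by blast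
  then have "\<gamma> \<noteq> 0" using c by auto
  with \<alpha> show thesis
    using that[of \<alpha> \<gamma> \<beta> h] pair_map_eq[of F] by (simp add: r F2 \<gamma>)
qed

section \<open>Degree reduction\<close>

text \<open>Affine automorphisms are covered: translations are shears by constants, and elementary
  and diagonal matrices generate the linear group.\<close>

definition tame :: "'a::field polymap \<Rightarrow> bool" where
  "tame F \<longleftrightarrow> (\<exists>a b. shear_reach (diag a b) F)"

lemma tame_cancel_shear: "tame (pmcomp (shear i p) F) \<Longrightarrow> tame F"
  unfolding tame_def by (meson shear_reach_cancel)

lemma tame_degree_0:
  assumes "poly_automorphism F" "degree (F $ 1) = 0"
  shows "tame F"
proof -
  obtain \<alpha> \<beta> \<gamma> h where *: "\<alpha> \<noteq> 0" "F = pair_map [:[:\<beta>, \<alpha>:]:] [:h, [:\<gamma>:]:]"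
    using automorphism_degree_0[OF assms] by metis
  have X: "bconst \<alpha> * Xs $ 1 = [:[:0, \<alpha>:]:]" "bconst \<gamma> * Xs $ 2 = [:0, [:\<gamma>:]:]"
    by (simp_all add: bconst_def Xs_def)
  have "h \<circ>\<^sub>p [:0, 1 / \<alpha>:] \<circ>\<^sub>p [:0, \<alpha>:] = h \<circ>\<^sub>p [:0, 1:]"
    using *(1) by (simp add: pcompose_assoc[symmetric] pcompose_pCons)
  then have h: "h \<circ>\<^sub>p [:0, 1 / \<alpha>:] \<circ>\<^sub>p [:0, \<alpha>:] = h"
    by simp
  \<comment> \<open>The second shear acts after \<open>diag\<close> and sees
    \<open>\<alpha> X_1\<close>, so its polynomial is \<open>h\<close> rescaled by
    \<open>1 / \<alpha>\<close>.\<close>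
  have "F = pmcomp (shear 1 [:\<beta>:]) (pmcomp (shear 2 (h \<circ>\<^sub>p [:0, 1 / \<alpha>:])) (diag \<alpha> \<gamma>))"
    by (simp add: diag_def X pmcomp_shear_pair_map upoly_const h) (simp add: *(2) bconst_def)
  then show ?thesis
    unfolding tame_def by (metis shear_reach.intros)
qed

text \<open>The first component of the inverse takes the value \<open>X_1\<close>, of order 0, at
  \<open>F\<close>. The bounds at infinity then force the smaller degree to divide the larger one,
  and the constant residue provides the coefficient cancelling the leading term in
  \<open>X_2\<close>.\<close>

lemma automorphism_reduction:
  fixes F :: "'a::field polymap"
  assumes "poly_automorphism F" "degree (F $ 1) \<le> degree (F $ 2)" "degree (F $ 1) \<noteq> 0"
  obtains c n where "degree (F $ 2 - bconst c * (F $ 1) ^ n) < degree (F $ 2)"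
proof -
  obtain G where "pmcomp G F = Xs"
    using assms by (auto simp: poly_automorphism_def)
  then have s: "subst (G $ i) F = Xs $ i" for i
    by (metis pmcomp_def vec_lambda_beta)
  obtain k where k: "k \<noteq> 0" "jacobian (F $ 1) (F $ 2) = bconst k"
    using det_jacobian_automorphism[OF assms(1)] unfolding det_jacobian_matrix by blast
  define x y where "x = laurent (F $ 1)" and "y = laurent (F $ 2)"
  define N where "N = gcd (degree (F $ 1)) (degree (F $ 2))"
  obtain q p where qp: "degree (F $ 1) = q * N" "degree (F $ 2) = p * N" "coprime q p"
    using gcd_coprime_exists[of "degree (F $ 1)" "degree (F $ 2)"] assms(3) unfolding N_def by auto
  have "N > 0" "q > 0"
    using qp(1) assms(3) by (metis gr0I mult_is_0)+
  moreover from this have "q \<le> p"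
    using qp assms(2) by simp
  ultimately have pos: "N > 0" "q > 0" "p > 0" "q \<le> p"
    by auto
  have nz: "F $ 1 \<noteq> 0" "F $ 2 \<noteq> 0" using assms(2,3) by auto
  note xy = laurent_subdegree[OF nz(1), folded x_def] laurent_subdegree[OF nz(2), folded y_def]
  have br: "bracket x y = - (fls_X_inv ^ 2 * scalar k)"
    by (simp add: x_def y_def bracket_laurent k)
  have sk: "scalar k \<noteq> 0" "fls_subdegree (scalar k) = 0"
    using k by (simp_all add: scalar_def)
  have br_nz: "bracket x y \<noteq> 0"
    using sk by (simp add: br)
  \<comment> \<open>The Jacobian is constant, so the order comes only from the factor
    \<open>fls_X_inv ^ 2\<close>.\<close>
  have br_sub: "fls_subdegree (bracket x y) = - 2"
    using sk by (simp add: br fls_subdegree_mult_fls_X_inv_power)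
  have "\<exists>i j. (i, j) \<in> supp (G $ 1) \<and> (i, j) \<noteq> (0, 0)"
  proof (rule ccontr)
    assume neg: "\<not> ?thesis"
    have "coeff (coeff (G $ 1) j) i = coeff (coeff (bconst (coeff (coeff (G $ 1) 0) 0)) j) i" for i j
    proof (cases "(i, j) = (0, 0)")
      case False
      then have "coeff (coeff (G $ 1) j) i = 0" using neg supp_iff by blast
      then show ?thesis using False by (auto simp: bconst_def coeff_pCons split: nat.splits)
    qed (simp add: bconst_def)
    then have "G $ 1 = bconst (coeff (coeff (G $ 1) 0) 0)"
      by (intro poly_eqI)
    then have "Xs $ 1 = bconst (coeff (coeff (G $ 1) 0) 0)"
      using s[of 1] subst_bconst by metis
    then show False by (simp add: Xs_def bconst_def)
  qed
  then obtain i j where ij: "(i, j) \<in> supp (G $ 1)" "(i, j) \<noteq> (0, 0)" by blast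
  have "eval2 x y (G $ 1) = laurent (Xs $ 1)"
    by (simp add: x_def y_def eval2_laurent s)
  also have "\<dots> = fls_const (laurent1 [:0, 1:])"
    by (simp add: laurent_def Xs_def eval1_laurent1[symmetric])
  finally have ord: "ord_ge (eval2 x y (G $ 1)) 0" by simp
  note weights = weights_at_infinity[of x y p q N, OF xy(1,3) pos(3,2,1) _ _ _ br_nz br_sub ij ord]
  have cop: "coprime p q" using qp by (simp add: coprime_commute)
  have pq: "p * q \<le> p + q" and "\<exists>c. c \<noteq> 0 \<and> ord_ge (x ^ p - scalar c * y ^ q) (1 - int (p * q * N))"
    using weights cop xy qp by auto
  then obtain c where c: "c \<noteq> 0" "ord_ge (x ^ p - scalar c * y ^ q) (1 - int (p * q * N))"
    by blast
  \<comment> \<open>For \<open>2 \<le> q \<le> p\<close> the inequality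
    \<open>p * q \<le> p + q\<close> leaves only \<open>p = q = 2\<close>, which coprimality
    excludes.\<close>
  have "q = 1"
  proof (rule ccontr)
    assume "q \<noteq> 1"
    then have q2: "q \<ge> 2" using pos by simp
    show False
    proof (cases "q = 2")
      case True
      then have "p = 2" using pq pos by simp
      then show False using cop True by simp
    next
      case False
      then have "p * 3 \<le> p * q" using q2 by (intro mult_left_mono) auto
      then show False using pq pos by linarith
    qed
  qed
  \<comment> \<open>For \<open>q = 1\<close> the series \<open>x ^ p - scalar c * y\<close> has
    order above that of \<open>y\<close>; dividing it by \<open>- c\<close> gives the reduced second
    component.\<close>
  define R where "R = F $ 2 - bconst (1 / c) * (F $ 1) ^ p"
  have "scalar (1 / c) * scalar c = 1"
    using c(1) by (simp flip: scalar_simps(4))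
  then have eR: "laurent R = scalar (- 1 / c) * (x ^ p - scalar c * y ^ q)"
    using \<open>q = 1\<close> by (simp add: R_def x_def y_def right_diff_distrib mult.assoc[symmetric])
      (simp add: scalar_def)
  have "ord_ge (scalar (- 1 / c) * (x ^ p - scalar c * y ^ q)) (0 + (1 - int (p * q * N)))"
    by (intro ord_ge_mult c(2) ord_ge_scalar)
  then have oR: "ord_ge (laurent R) (1 - int (degree (F $ 2)))"
    using eR \<open>q = 1\<close> qp by simp
  have "degree R < degree (F $ 2)"
  proof (cases "R = 0")
    case True
    then show ?thesis using pos qp by simp
  next
    case False
    then show ?thesis using oR laurent_subdegree[OF False] ord_ge_iff by fastforce
  qed
  then show thesis unfolding R_def by (rule that)
qed

lemma automorphism_tame:
  fixes F :: "'a::field polymap"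
  assumes "poly_automorphism F"
  shows "tame F"
  using assms
proof (induction "degree (F $ 1) + degree (F $ 2)" arbitrary: F rule: less_induct)
  case less
  have core: "tame H"
    if H: "poly_automorphism H" "degree (H $ 1) \<le> degree (H $ 2)"
      "degree (H $ 1) + degree (H $ 2) = degree (F $ 1) + degree (F $ 2)" for H :: "'a polymap"
  proof (cases "degree (H $ 1) = 0")
    case True
    then show ?thesis using tame_degree_0 H by blast
  next
    case False
    then obtain c n where c: "degree (H $ 2 - bconst c * (H $ 1) ^ n) < degree (H $ 2)"
      using automorphism_reduction H by blast
    define H' where "H' = pmcomp (shear 2 (- monom c n)) H"
    have "H' $ 1 = H $ 1" "H' $ 2 = H $ 2 - bconst c * (H $ 1) ^ n"
      by (simp_all add: H'_def pmcomp_shear_nth)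
    then have "tame H'"
      using less.hyps[of H'] c H
      by (simp add: H'_def poly_automorphism_pmcomp poly_automorphism_shear)
    then show ?thesis unfolding H'_def by (rule tame_cancel_shear)
  qed
  show ?case
  proof (cases "degree (F $ 1) \<le> degree (F $ 2)")
    case True
    then show ?thesis using core less.prems by blast
  next
    case False
    \<comment> \<open>The swap with a sign exchanges the degrees and, unlike the plain one in odd or
      zero characteristic, has determinant 1, so it is a product of shears.\<close>
    define H where "H = pair_map (bconst 1 * F $ 2) (bconst (- 1 / 1) * F $ 1)"
    have H: "H = pmcomp (shear 1 [:0, 1:]) (pmcomp (shear 2 [:0, - 1 / 1:]) (pmcomp (shear 1 [:0, 1:]) F))"
      unfolding H_def by (subst (3) pair_map_eq) (rule rotate_eq, simp)
    have "tame H"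
    proof (rule core)
      show "poly_automorphism H"
        unfolding H by (intro poly_automorphism_pmcomp poly_automorphism_shear less.prems)
    qed (use False in \<open>simp_all add: H_def\<close>)
    then show ?thesis
      unfolding H by (meson tame_cancel_shear)
  qed
qed

theorem corollary10:
  fixes F :: "'a::field polymap"
  assumes "poly_automorphism F"
  shows "(\<exists>Fs. (\<forall>G\<in>set Fs. poly_automorphism G \<and> pascal_finite G) \<and> F = pmcomp_list Fs)
    \<longleftrightarrow> det (jacobian_matrix F) = 1"
proof
  assume "\<exists>Fs. (\<forall>G\<in>set Fs. poly_automorphism G \<and> pascal_finite G) \<and> F = pmcomp_list Fs"
  then show "det (jacobian_matrix F) = 1"
    using det_jacobian_pmcomp_list pascal_finite_det_jacobian by blast
next
  assume det: "det (jacobian_matrix F) = 1"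
  obtain a b where ab: "shear_reach (diag a b) F"
    using automorphism_tame[OF assms] by (auto simp: tame_def)
  \<comment> \<open>Shears preserve the determinant, so the diagonal factor left by the reduction
    has determinant 1 and is itself a product of shears.\<close>
  then have "bconst (a * b) = (bconst 1 :: 'a bipoly)"
    using det det_jacobian_shear_reach[OF ab] det_jacobian_diag[of a b] by simp
  then have "a * b = 1" by (simp only: bconst_eq_iff)
  then have "shear_reach Xs F"
    using shear_reach_diag shear_reach_trans ab by blast
  then show "\<exists>Fs. (\<forall>G\<in>set Fs. poly_automorphism G \<and> pascal_finite G) \<and> F = pmcomp_list Fs"
    by (rule shear_reach_list)
qed

end
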